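(* Let $V$ be a $\tau(B)$-module with finite dimensional weight spaces with respect to $H$. Then $V$ is integrable as a $\tau(B)$-module if and only if it is integrable as a $\tau$-module.
   Context: Everything is over $\mathbb C$. $\dot{\mathfrak g}$ is a finite dimensional simple Lie algebra with Cartan subalgebra $\dot{\mathfrak h}$, root system $\dot\Delta$, and normalized invariant non-degenerate symmetric bilinear form $(\cdot,\cdot)$. $n\ge 1$ is an integer and $B$ is a commutative associative finitely generated unital $\mathbb C$-algebra. $A=\mathbb C[t_0^{\pm1},\dots,t_n^{\pm1}]$, $t^{\underline m}=t_1^{m_1}\cdots t_n^{m_n}$ for $\underline m\in\mathbb Z^n$. $\Omega_A$ is the vector space with basis $t_0^{k_0}t^{\underline k}K_i$ ($0\le i\le n$, $k_0\in\mathbb Z$, $\underline k\in\mathbb Z^n$), $dA$ is the span of the elements $\sum_{i=0}^n k_i t_0^{k_0}t^{\underline k}K_i$, and $Z=\Omega_A/dA$. $\tau_0=\dot{\mathfrak g}\otimes A\oplus Z$ with $Z$ central and $[x\otimes t_0^{k_0}t^{\underline k},y\otimes t_0^{r_0}t^{\underline r}]=[x,y]\otimes t_0^{k_0+r_0}t^{\underline k+\underline r}+(x,y)\sum_{i=0}^n k_i t_0^{k_0+r_0}t^{\underline k+\underline r}K_i$. $\tau(B)=\tau_0\otimes B\oplus D$, $D=\mathrm{span}\{d_0,\dots,d_n\}$, with $[x\otimes b,y\otimes b']=[x,y]\otimes bb'$, $[d_i,x\otimes t_0^{k_0}t^{\underline k}\otimes b]=k_i\,x\otimes t_0^{k_0}t^{\underline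 k}\otimes b$, $[d_i,t_0^{k_0}t^{\underline k}K_j\otimes b]=k_i\,t_0^{k_0}t^{\underline k}K_j\otimes b$, $[d_i,d_j]=0$. The toroidal Lie algebra $\tau=\tau_0\oplus D$ is identified with the subalgebra $\tau_0\otimes1\oplus D$ of $\tau(B)$. $H=\dot{\mathfrak h}\oplus\bigoplus_{i=0}^n\mathbb CK_i\oplus\bigoplus_{i=0}^n\mathbb Cd_i$ (with $\dot{\mathfrak h}=\dot{\mathfrak h}\otimes1\otimes1$, $K_i=K_i\otimes1$) is a Cartan subalgebra of both. For $\lambda\in H^*$, $V_\lambda=\{v\in V:hv=\lambda(h)v\ \forall h\in H\}$ is a weight space. $V$ is integrable for $\tau(B)$ if (1) $V=\bigoplus_{\lambda\in H^*}V_\lambda$, and (2) for all $\alpha\in\dot\Delta$, $(m_0,\underline m)\in\mathbb Z^{n+1}$, $b\in B$ and $v\in V$ there is an integer $k=k(\alpha,(m_0,\underline m),b,v)$ with $(X_\alpha\otimes t_0^{m_0}t^{\underline m}\otimes b)^k v=0$, where $X_\alpha$ is a root vector of root $\alpha$. $V$ is integrable for $\tau$ if (1) holds and (2) holds for $b=1$. *)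

theory Defs
  imports "HOL-Analysis.Finite_Cartesian_Product" "HOL-Library.Poly_Mapping"
    "HOL-Library.Product_Plus" "HOL-Library.FuncSet"
begin

section \<open>Complex vector spaces\<close>

class scaleC =
  fixes scaleC :: "complex \<Rightarrow> 'a \<Rightarrow> 'a"  (infixr \<open>*\<^sub>C\<close> 75)

class complex_vector = scaleC + ab_group_add +
  assumes scaleC_add_right: "a *\<^sub>C (x + y) = a *\<^sub>C x + a *\<^sub>C y"
    and scaleC_add_left: "(a + b) *\<^sub>C x = a *\<^sub>C x + b *\<^sub>C x"
    and scaleC_scaleC: "a *\<^sub>C (b *\<^sub>C x) = (a * b) *\<^sub>C x"
    and scaleC_one: "1 *\<^sub>C x = x"

global_interpretation complex_vector: vector_space "scaleC :: complex \<Rightarrow> 'a \<Rightarrow> 'a::complex_vector"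
  defines csubspace = complex_vector.subspace
    and cspan = complex_vector.span
  by unfold_locales (simp_all add: scaleC_add_right scaleC_add_left scaleC_scaleC scaleC_one)

abbreviation clinear :: "('a::complex_vector \<Rightarrow> 'b::complex_vector) \<Rightarrow> bool"
  where "clinear \<equiv> Vector_Spaces.linear scaleC scaleC"

definition cbilinear :: "('a::complex_vector \<Rightarrow> 'b::complex_vector \<Rightarrow> 'c::complex_vector) \<Rightarrow> bool"
  where "cbilinear f \<longleftrightarrow> (\<forall>x. clinear (f x)) \<and> (\<forall>y. clinear (\<lambda>x. f x y))"

definition finite_dim :: "'a::complex_vector set \<Rightarrow> bool"
  where "finite_dim S \<longleftrightarrow> (\<exists>F. finite F \<and> cspan F = S)"

text \<open>The dual of a subspace \<open>S\<close>. Functionals on \<open>S\<close> are represented by functions on the ambient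
  type that are \<^const>\<open>undefined\<close> off \<open>S\<close>, so that each functional has exactly one representative.\<close>

definition dual_space :: "'a::complex_vector set \<Rightarrow> ('a \<Rightarrow> complex) set"
  where "dual_space S = {f \<in> extensional S.
    (\<forall>x\<in>S. \<forall>y\<in>S. f (x + y) = f x + f y) \<and> (\<forall>c. \<forall>x\<in>S. f (c *\<^sub>C x) = c * f x)}"

text \<open>The whole type is the internal direct sum of the subspaces \<open>W i\<close>, \<open>i \<in> I\<close>.\<close>

definition is_direct_sum :: "'i set \<Rightarrow> ('i \<Rightarrow> 'a::complex_vector set) \<Rightarrow> bool"
  where "is_direct_sum I W \<longleftrightarrow> (\<forall>v. \<exists>!f :: 'i \<Rightarrow>\<^sub>0 'a.
    Poly_Mapping.keys f \<subseteq> I \<and> (\<forall>i\<in>I. Poly_Mapping.lookup f i \<in> W i) \<and>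
    v = (\<Sum>i\<in>Poly_Mapping.keys f. Poly_Mapping.lookup f i))"

instantiation complex :: complex_vector
begin
definition scaleC_complex :: "complex \<Rightarrow> complex \<Rightarrow> complex"
  where "scaleC_complex = (*)"
instance by standard (simp_all add: scaleC_complex_def algebra_simps)
end

instantiation prod :: (complex_vector, complex_vector) complex_vector
begin
definition scaleC_prod :: "complex \<Rightarrow> 'a \<times> 'b \<Rightarrow> 'a \<times> 'b"
  where "scaleC_prod c p = (c *\<^sub>C fst p, c *\<^sub>C snd p)"
instance by standard
  (simp_all add: scaleC_prod_def prod_eq_iff scaleC_add_right scaleC_add_left scaleC_scaleC scaleC_one)
end

instantiation vec :: (complex_vector, finite) complex_vector
begin
definition scaleC_vec :: "complex \<Rightarrow> ('a, 'b) vec \<Rightarrow> ('a, 'b) vec"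
  where "scaleC_vec c v = (\<chi> i. c *\<^sub>C (v $ i))"
instance by standard
  (simp_all add: scaleC_vec_def vec_eq_iff scaleC_add_right scaleC_add_left scaleC_scaleC scaleC_one)
end

instantiation poly_mapping :: (type, complex_vector) complex_vector
begin
definition scaleC_poly_mapping :: "complex \<Rightarrow> ('a \<Rightarrow>\<^sub>0 'b) \<Rightarrow> 'a \<Rightarrow>\<^sub>0 'b"
  where "scaleC_poly_mapping c = Poly_Mapping.map (scaleC c)"

lemma lookup_scaleC [simp]:
  "Poly_Mapping.lookup (c *\<^sub>C p) k = c *\<^sub>C Poly_Mapping.lookup p k"
  by (simp add: scaleC_poly_mapping_def Poly_Mapping.map.rep_eq when_def)

instance by standard
  (rule poly_mapping_eqI,
   simp add: lookup_add scaleC_add_right scaleC_add_left scaleC_scaleC scaleC_one)+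
end


lemma clinearI:
  "(\<And>x y. f (x + y) = f x + f y) \<Longrightarrow> (\<And>c x. f (c *\<^sub>C x) = c *\<^sub>C f x) \<Longrightarrow> clinear f"
  by unfold_locales

lemma clinearD:
  assumes "clinear f"
  shows "f (x + y) = f x + f y" "f (x - y) = f x - f y" "f 0 = 0" "f (c *\<^sub>C x) = c *\<^sub>C f x"
    "f (- x) = - f x" "f (sum g S) = (\<Sum>i\<in>S. f (g i))"
proof -
  interpret Vector_Spaces.linear scaleC scaleC f by fact
  show "f (x + y) = f x + f y" "f (x - y) = f x - f y" "f 0 = 0" "f (c *\<^sub>C x) = c *\<^sub>C f x"
    "f (- x) = - f x" "f (sum g S) = (\<Sum>i\<in>S. f (g i))"
    by (fact add diff zero scale neg sum)+
qed

lemma clinear_zero_on_span: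
  assumes "clinear f" "\<And>x. x \<in> S \<Longrightarrow> f x = 0" "x \<in> cspan S"
  shows "f x = 0"
  using assms(3)
  by (induction rule: complex_vector.span_induct_alt)
    (simp_all add: clinearD[OF assms(1)] assms(2))

lemma cbilinearI:
  "(\<And>x. clinear (f x)) \<Longrightarrow> (\<And>y. clinear (\<lambda>x. f x y)) \<Longrightarrow> cbilinear f"
  by (simp add: cbilinear_def)

lemma equivp_mod_subspace:
  assumes "csubspace S"
  shows "equivp (\<lambda>x y. x - y \<in> S)"
proof (rule equivpI)
  show "reflp (\<lambda>x y. x - y \<in> S)"
    by (rule reflpI) (simp add: complex_vector.subspace_0[OF assms])
  show "symp (\<lambda>x y. x - y \<in> S)"
    by (rule sympI) (metis assms complex_vector.subspace_neg minus_diff_eq)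
  show "transp (\<lambda>x y. x - y \<in> S)"
    by (rule transpI) (metis assms complex_vector.subspace_add diff_add_cancel add_diff_eq)
qed

lemma mod_subspace:
  assumes "csubspace S"
  shows "p - p' \<in> S \<Longrightarrow> q - q' \<in> S \<Longrightarrow> (p + q) - (p' + q') \<in> S"
    and "p - p' \<in> S \<Longrightarrow> q - q' \<in> S \<Longrightarrow> (p - q) - (p' - q') \<in> S"
    and "p - p' \<in> S \<Longrightarrow> - p - - p' \<in> S"
    and "p - p' \<in> S \<Longrightarrow> c *\<^sub>C p - c *\<^sub>C p' \<in> S"
proof -
  show "p - p' \<in> S \<Longrightarrow> q - q' \<in> S \<Longrightarrow> (p + q) - (p' + q') \<in> S"
    using complex_vector.subspace_add[OF assms, of "p - p'" "q - q'"] by (simp add: add_diff_add)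
  show "p - p' \<in> S \<Longrightarrow> q - q' \<in> S \<Longrightarrow> (p - q) - (p' - q') \<in> S"
    using complex_vector.subspace_diff[OF assms, of "p - p'" "q - q'"] by (simp add: algebra_simps)
  show "p - p' \<in> S \<Longrightarrow> - p - - p' \<in> S"
    using complex_vector.subspace_neg[OF assms, of "p - p'"] by simp
  show "p - p' \<in> S \<Longrightarrow> c *\<^sub>C p - c *\<^sub>C p' \<in> S"
    using complex_vector.subspace_scale[OF assms, of "p - p'" c]
    by (simp add: complex_vector.scale_right_diff_distrib)
qed

text \<open>The type \<^typ>\<open>'k \<Rightarrow>\<^sub>0 complex\<close> is the vector space with basis \<open>'k\<close>, the basis vector of \<open>k\<close>
  being \<open>single k 1\<close>.\<close>

abbreviation basis_vector :: "'k \<Rightarrow> 'k \<Rightarrow>\<^sub>0 complex"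
  where "basis_vector k \<equiv> Poly_Mapping.single k 1"

definition lin_ext :: "('k \<Rightarrow> 'a::complex_vector) \<Rightarrow> ('k \<Rightarrow>\<^sub>0 complex) \<Rightarrow> 'a"
  where "lin_ext f p = (\<Sum>k\<in>Poly_Mapping.keys p. Poly_Mapping.lookup p k *\<^sub>C f k)"

lemma lin_ext_superset:
  assumes "finite A" "Poly_Mapping.keys p \<subseteq> A"
  shows "lin_ext f p = (\<Sum>k\<in>A. Poly_Mapping.lookup p k *\<^sub>C f k)"
  unfolding lin_ext_def
  by (rule sum.mono_neutral_left) (use assms in \<open>auto simp: in_keys_iff\<close>)

lemma clinear_lin_ext: "clinear (lin_ext f)"
proof (rule clinearI)
  fix p q :: "'a \<Rightarrow>\<^sub>0 complex" and c :: complex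
  let ?A = "Poly_Mapping.keys p \<union> Poly_Mapping.keys q"
  have "lin_ext f r = (\<Sum>k\<in>?A. Poly_Mapping.lookup r k *\<^sub>C f k)"
    if "Poly_Mapping.keys r \<subseteq> ?A" for r
    by (rule lin_ext_superset) (use that in auto)
  moreover have "Poly_Mapping.keys (p + q) \<subseteq> ?A"
    by (rule Poly_Mapping.keys_add)
  ultimately show "lin_ext f (p + q) = lin_ext f p + lin_ext f q"
    by (simp add: lookup_add scaleC_add_left sum.distrib)
  have "Poly_Mapping.keys (c *\<^sub>C p) \<subseteq> Poly_Mapping.keys p"
    by (auto simp: in_keys_iff)
  then show "lin_ext f (c *\<^sub>C p) = c *\<^sub>C lin_ext f p"
    by (simp add: lin_ext_superset[of "Poly_Mapping.keys p"] complex_vector.scale_sum_right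
        scaleC_scaleC scaleC_complex_def)
qed

lemma lin_ext_basis [simp]: "lin_ext f (basis_vector k) = f k"
  by (simp add: lin_ext_def scaleC_one)

lemma lin_ext_fun:
  "lin_ext (\<lambda>k. f k + g k) p = lin_ext f p + lin_ext g p"
  "lin_ext (\<lambda>k. c *\<^sub>C f k) p = c *\<^sub>C lin_ext f p"
  by (simp_all add: lin_ext_def scaleC_add_right sum.distrib complex_vector.scale_sum_right
      scaleC_scaleC mult.commute)

lemma lin_ext_cong_clinear:
  assumes "clinear g"
  shows "g p = lin_ext (\<lambda>k. g (basis_vector k)) p"
proof -
  have "p = (\<Sum>k\<in>Poly_Mapping.keys p. Poly_Mapping.lookup p k *\<^sub>C basis_vector k)"
    by (rule poly_mapping_eqI)
      (auto simp: Poly_Mapping.lookup_sum lookup_single scaleC_complex_def when_def in_keys_iff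
        if_distrib[of "\<lambda>x. _ * x"] cong: if_cong)
  then have "g p = g (\<Sum>k\<in>Poly_Mapping.keys p. Poly_Mapping.lookup p k *\<^sub>C basis_vector k)"
    by simp
  also have "\<dots> = lin_ext (\<lambda>k. g (basis_vector k)) p"
    by (simp add: clinearD[OF assms] lin_ext_def)
  finally show ?thesis .
qed

lemma free_induct [case_names basis scale add]:
  fixes p :: "'k \<Rightarrow>\<^sub>0 complex"
  assumes basis: "\<And>k. P (basis_vector k)" and scale: "\<And>c p. P p \<Longrightarrow> P (c *\<^sub>C p)"
    and add: "\<And>p q. P p \<Longrightarrow> P q \<Longrightarrow> P (p + q)"
  shows "P p"
proof -
  have "P (0 *\<^sub>C basis_vector undefined)"
    by (intro scale basis)
  then have "P 0"
    by simp
  have "P (\<Sum>k\<in>A. c k *\<^sub>C basis_vector k)" if "finite A" for A :: "'k set" and c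
    using that \<open>P 0\<close> by (induction rule: finite_induct) (simp_all add: basis scale add)
  then have "P (lin_ext basis_vector p)"
    by (simp add: lin_ext_def)
  then show ?thesis
    using lin_ext_cong_clinear[of id p] by (simp add: clinearI)
qed


section \<open>Tensor products\<close>

definition tensor_relations :: "('a::complex_vector \<times> 'b::complex_vector \<Rightarrow>\<^sub>0 complex) set"
  where "tensor_relations =
    {basis_vector (x + x', y) - basis_vector (x, y) - basis_vector (x', y) | x x' y. True} \<union>
    {basis_vector (x, y + y') - basis_vector (x, y) - basis_vector (x, y') | x y y'. True} \<union>
    {basis_vector (c *\<^sub>C x, y) - c *\<^sub>C basis_vector (x, y) | c x y. True} \<union>
    {basis_vector (x, c *\<^sub>C y) - c *\<^sub>C basis_vector (x, y) | c x y. True}"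

quotient_type (overloaded) ('a, 'b) tensor = "'a::complex_vector \<times> 'b::complex_vector \<Rightarrow>\<^sub>0 complex"
  / "\<lambda>p q. p - q \<in> cspan tensor_relations"
  by (rule equivp_mod_subspace) (rule complex_vector.subspace_span)

instantiation tensor :: (complex_vector, complex_vector) complex_vector
begin

lift_definition zero_tensor :: "('a, 'b) tensor" is 0 .

lift_definition plus_tensor :: "('a, 'b) tensor \<Rightarrow> ('a, 'b) tensor \<Rightarrow> ('a, 'b) tensor" is "(+)"
  by (rule mod_subspace(1)[OF complex_vector.subspace_span])

lift_definition minus_tensor :: "('a, 'b) tensor \<Rightarrow> ('a, 'b) tensor \<Rightarrow> ('a, 'b) tensor" is "(-)"
  by (rule mod_subspace(2)[OF complex_vector.subspace_span])

lift_definition uminus_tensor :: "('a, 'b) tensor \<Rightarrow> ('a, 'b) tensor" is uminus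
  by (rule mod_subspace(3)[OF complex_vector.subspace_span])

lift_definition scaleC_tensor :: "complex \<Rightarrow> ('a, 'b) tensor \<Rightarrow> ('a, 'b) tensor" is scaleC
  by (rule mod_subspace(4)[OF complex_vector.subspace_span])

instance
  by standard
    (transfer; simp add: algebra_simps scaleC_add_right scaleC_add_left scaleC_scaleC scaleC_one
      complex_vector.span_zero)+

end

lift_definition pure_tensor :: "'a::complex_vector \<Rightarrow> 'b::complex_vector \<Rightarrow> ('a, 'b) tensor"
    (infixr \<open>\<otimes>\<close> 72)
  is "\<lambda>x y. basis_vector (x, y)" .

text \<open>The linear map on the tensor product induced by a bilinear map \<open>f\<close>.\<close>

definition tensor_lift :: "('a::complex_vector \<Rightarrow> 'b::complex_vector \<Rightarrow> 'c::complex_vector) \<Rightarrow>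
    ('a, 'b) tensor \<Rightarrow> 'c"
  where "tensor_lift f t = lin_ext (\<lambda>(x, y). f x y) (rep_tensor t)"

lemma tensor_add_left: "(x + x') \<otimes> y = x \<otimes> y + x' \<otimes> y"
  by transfer (rule complex_vector.span_base, unfold tensor_relations_def, simp only: diff_diff_eq[symmetric], blast)

lemma tensor_add_right: "x \<otimes> (y + y') = x \<otimes> y + x \<otimes> y'"
  by transfer (rule complex_vector.span_base, unfold tensor_relations_def, simp only: diff_diff_eq[symmetric], blast)

lemma tensor_scale_left: "(c *\<^sub>C x) \<otimes> y = c *\<^sub>C (x \<otimes> y)"
  by transfer (rule complex_vector.span_base, unfold tensor_relations_def, blast)

lemma tensor_scale_right: "x \<otimes> (c *\<^sub>C y) = c *\<^sub>C (x \<otimes> y)"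
  by transfer (rule complex_vector.span_base, unfold tensor_relations_def, blast)

lemma tensor_sum_left: "(\<Sum>i\<in>I. f i) \<otimes> y = (\<Sum>i\<in>I. f i \<otimes> y)"
proof -
  have "clinear (\<lambda>x. x \<otimes> y)"
    by (rule clinearI) (simp_all only: tensor_add_left tensor_scale_left)
  then show ?thesis
    by (rule clinearD(6))
qed

lemma cbilinear_pure_tensor: "cbilinear (\<otimes>)"
  by (intro cbilinearI clinearI)
    (simp_all add: tensor_add_left tensor_add_right tensor_scale_left tensor_scale_right)

lemma abs_rep_tensor: "abs_tensor (rep_tensor t) = t"
  by (rule Quotient3_abs_rep[OF Quotient3_tensor])

lemma abs_tensor_eq_iff: "abs_tensor p = abs_tensor q \<longleftrightarrow> p - q \<in> cspan tensor_relations"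
  by (rule tensor.abs_eq_iff)

lemma clinear_abs_tensor: "clinear abs_tensor"
  by (rule clinearI) (simp_all add: plus_tensor.abs_eq scaleC_tensor.abs_eq)

lemma tensor_lift_abs:
  assumes "cbilinear f"
  shows "tensor_lift f (abs_tensor p) = lin_ext (\<lambda>(x, y). f x y) p"
proof -
  let ?F = "lin_ext (\<lambda>(x, y). f x y)"
  note lin = clinearD[OF clinear_lin_ext]
  have f: "clinear (f x)" "clinear (\<lambda>x. f x y)" for x y
    using assms by (auto simp: cbilinear_def)
  have "rep_tensor (abs_tensor p) - p \<in> cspan tensor_relations"
    by (metis abs_rep_tensor abs_tensor_eq_iff)
  then have "?F (rep_tensor (abs_tensor p) - p) = 0"
    by (rule clinear_zero_on_span[OF clinear_lin_ext, rotated])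
      (auto simp: tensor_relations_def lin clinearD[OF f(1)] clinearD[OF f(2)])
  then show ?thesis
    by (simp add: lin tensor_lift_def)
qed

lemma clinear_tensor_lift:
  assumes "cbilinear f"
  shows "clinear (tensor_lift f)"
proof (rule clinearI)
  note lin = clinearD[OF clinear_lin_ext]
  fix s t c
  show "tensor_lift f (s + t) = tensor_lift f s + tensor_lift f t"
    using tensor_lift_abs[OF assms, of "rep_tensor s + rep_tensor t"]
    by (simp add: clinearD[OF clinear_abs_tensor] abs_rep_tensor lin tensor_lift_def)
  show "tensor_lift f (c *\<^sub>C t) = c *\<^sub>C tensor_lift f t"
    using tensor_lift_abs[OF assms, of "c *\<^sub>C rep_tensor t"]
    by (simp add: clinearD[OF clinear_abs_tensor] abs_rep_tensor lin tensor_lift_def)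
qed

lemma tensor_lift_pure:
  assumes "cbilinear f"
  shows "tensor_lift f (x \<otimes> y) = f x y"
  by (simp add: pure_tensor.abs_eq tensor_lift_abs[OF assms])

lemma tensor_induct [case_names pure add]:
  assumes pure: "\<And>x y. P (x \<otimes> y)" and add: "\<And>s t. P s \<Longrightarrow> P t \<Longrightarrow> P (s + t)"
  shows "P t"
proof -
  have "P (abs_tensor (\<Sum>k\<in>A. c k *\<^sub>C basis_vector k))" if "finite A" for A and c :: "'a \<times> 'b \<Rightarrow> complex"
    using that
  proof induction
    case empty
    have "P (0 *\<^sub>C (0 \<otimes> 0))"
      using pure[of "0 *\<^sub>C 0" 0] by (simp only: tensor_scale_left)
    then show ?case
      by (simp add: clinearD[OF clinear_abs_tensor])
  next
    case (insert k A)
    obtain x y where k: "k = (x, y)"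
      by (cases k)
    have "abs_tensor (c k *\<^sub>C basis_vector k) = (c k *\<^sub>C x) \<otimes> y"
      by (simp only: k clinearD[OF clinear_abs_tensor] tensor_scale_left pure_tensor.abs_eq[symmetric])
    with insert add pure show ?case
      by (simp add: clinearD(1)[OF clinear_abs_tensor])
  qed
  from this[of "Poly_Mapping.keys (rep_tensor t)" "Poly_Mapping.lookup (rep_tensor t)"]
  have "P (abs_tensor (lin_ext basis_vector (rep_tensor t)))"
    by (simp add: lin_ext_def)
  moreover have "lin_ext basis_vector p = p" for p :: "'a \<times> 'b \<Rightarrow>\<^sub>0 complex"
    using lin_ext_cong_clinear[of id p] by (simp add: clinearI)
  ultimately show ?thesis
    by (simp add: abs_rep_tensor)
qed

text \<open>The bilinear map on two tensor products induced by a map \<open>F\<close> that is linear in each of its four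
  arguments.\<close>

definition tensor_lift2 ::
    "('a::complex_vector \<Rightarrow> 'b::complex_vector \<Rightarrow> 'c::complex_vector \<Rightarrow> 'd::complex_vector \<Rightarrow>
      'e::complex_vector) \<Rightarrow> ('a, 'b) tensor \<Rightarrow> ('c, 'd) tensor \<Rightarrow> 'e"
  where "tensor_lift2 F s t = tensor_lift (\<lambda>x a. tensor_lift (F x a) t) s"

context
  fixes F :: "'a::complex_vector \<Rightarrow> 'b::complex_vector \<Rightarrow> 'c::complex_vector \<Rightarrow> 'd::complex_vector \<Rightarrow>
      'e::complex_vector"
  assumes F1: "\<And>x a. cbilinear (F x a)" and F2: "\<And>y b. cbilinear (\<lambda>x a. F x a y b)"
begin

private lemma bil: "cbilinear (\<lambda>x a. tensor_lift (F x a) t)"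
proof -
  note l = clinearD[OF clinear_tensor_lift[OF F1]] and lp = tensor_lift_pure[OF F1]
  have "clinear (F x a y)" "clinear (\<lambda>y. F x a y b)" "clinear (\<lambda>a. F x a y b)" "clinear (\<lambda>x. F x a y b)"
    for x a y b
    using F1 F2 by (auto simp: cbilinear_def)
  note d = this[THEN clinearD(1)] this[THEN clinearD(4)]
  show ?thesis
  proof (intro cbilinearI clinearI)
    show "tensor_lift (F x (a + a')) t = tensor_lift (F x a) t + tensor_lift (F x a') t" for x a a'
    proof (induction t rule: tensor_induct)
      case (pure y b)
      show ?case by (simp only: lp) (simp only: d)
    next
      case (add s t)
      then show ?case by (simp only: l ac_simps)
    qed
    show "tensor_lift (F x (c *\<^sub>C a)) t = c *\<^sub>C tensor_lift (F x a) t" for x a c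
    proof (induction t rule: tensor_induct)
      case (pure y b)
      show ?case by (simp only: lp) (simp only: d)
    next
      case (add s t)
      then show ?case by (simp only: l scaleC_add_right)
    qed
    show "tensor_lift (F (x + x') a) t = tensor_lift (F x a) t + tensor_lift (F x' a) t" for x x' a
    proof (induction t rule: tensor_induct)
      case (pure y b)
      show ?case by (simp only: lp) (simp only: d)
    next
      case (add s t)
      then show ?case by (simp only: l ac_simps)
    qed
    show "tensor_lift (F (c *\<^sub>C x) a) t = c *\<^sub>C tensor_lift (F x a) t" for x a c
    proof (induction t rule: tensor_induct)
      case (pure y b)
      show ?case by (simp only: lp) (simp only: d)
    next
      case (add s t)
      then show ?case by (simp only: l scaleC_add_right)
    qed
  qed
qed

lemma tensor_lift2_pure: "tensor_lift2 F (x \<otimes> a) (y \<otimes> b) = F x a y b"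
  unfolding tensor_lift2_def by (rule trans[OF tensor_lift_pure[OF bil] tensor_lift_pure[OF F1]])

lemma cbilinear_tensor_lift2: "cbilinear (tensor_lift2 F)"
proof -
  note l = clinearD[OF clinear_tensor_lift[OF F1]]
  note b = clinearD[OF clinear_tensor_lift[OF bil]] and bp = tensor_lift_pure[OF bil]
  have "clinear (tensor_lift2 F s)" for s
  proof (rule clinearI)
    show "tensor_lift2 F s (t + t') = tensor_lift2 F s t + tensor_lift2 F s t'" for t t'
      unfolding tensor_lift2_def
    proof (induction s rule: tensor_induct)
      case (pure x y)
      show ?case by (simp only: bp) (simp only: l)
    next
      case (add s s')
      then show ?case by (simp only: b ac_simps)
    qed
    show "tensor_lift2 F s (c *\<^sub>C t) = c *\<^sub>C tensor_lift2 F s t" for c t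
      unfolding tensor_lift2_def
    proof (induction s rule: tensor_induct)
      case (pure x y)
      show ?case by (simp only: bp) (simp only: l)
    next
      case (add s s')
      then show ?case by (simp only: b scaleC_add_right)
    qed
  qed
  moreover have "clinear (\<lambda>s. tensor_lift2 F s t)" for t
    unfolding tensor_lift2_def by (rule clinear_tensor_lift[OF bil])
  ultimately show ?thesis
    by (rule cbilinearI)
qed

end


section \<open>Lie algebras\<close>

definition lie_algebra :: "('a::complex_vector \<Rightarrow> 'a \<Rightarrow> 'a) \<Rightarrow> bool"
  where "lie_algebra br \<longleftrightarrow> cbilinear br \<and> (\<forall>x. br x x = 0) \<and>
    (\<forall>x y z. br x (br y z) + br y (br z x) + br z (br x y) = 0)"

definition simple_lie_algebra :: "('a::complex_vector \<Rightarrow> 'a \<Rightarrow> 'a) \<Rightarrow> bool"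
  where "simple_lie_algebra br \<longleftrightarrow> lie_algebra br \<and> (\<exists>x y. br x y \<noteq> 0) \<and>
    (\<forall>I. csubspace I \<and> (\<forall>x. \<forall>y\<in>I. br x y \<in> I) \<longrightarrow> I = {0} \<or> I = UNIV)"

definition lie_module ::
    "('a::complex_vector \<Rightarrow> 'a \<Rightarrow> 'a) \<Rightarrow> ('a \<Rightarrow> 'v::complex_vector \<Rightarrow> 'v) \<Rightarrow> bool"
  where "lie_module br \<rho> \<longleftrightarrow> cbilinear \<rho> \<and>
    (\<forall>x y v. \<rho> (br x y) v = \<rho> x (\<rho> y v) - \<rho> y (\<rho> x v))"

text \<open>Cartan subalgebras of a semisimple Lie algebra: abelian, equal to their own centralizer, and
  acting diagonalizably in the adjoint representation.\<close>

definition cartan_subalgebra :: "('a::complex_vector \<Rightarrow> 'a \<Rightarrow> 'a) \<Rightarrow> 'a set \<Rightarrow> bool"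
  where "cartan_subalgebra br \<hh> \<longleftrightarrow> csubspace \<hh> \<and>
    (\<forall>h\<in>\<hh>. \<forall>h'\<in>\<hh>. br h h' = 0) \<and>
    (\<forall>x. (\<forall>h\<in>\<hh>. br h x = 0) \<longrightarrow> x \<in> \<hh>) \<and>
    (\<forall>h\<in>\<hh>. cspan {x. \<exists>c. br h x = c *\<^sub>C x} = UNIV)"

definition root_space ::
    "('a::complex_vector \<Rightarrow> 'a \<Rightarrow> 'a) \<Rightarrow> 'a set \<Rightarrow> ('a \<Rightarrow> complex) \<Rightarrow> 'a set"
  where "root_space br \<hh> \<alpha> = {x. \<forall>h\<in>\<hh>. br h x = \<alpha> h *\<^sub>C x}"

definition roots :: "('a::complex_vector \<Rightarrow> 'a \<Rightarrow> 'a) \<Rightarrow> 'a set \<Rightarrow> ('a \<Rightarrow> complex) set"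
  where "roots br \<hh> = {\<alpha> \<in> dual_space \<hh>. (\<exists>h\<in>\<hh>. \<alpha> h \<noteq> 0) \<and> root_space br \<hh> \<alpha> \<noteq> {0}}"

definition root_vector ::
    "('a::complex_vector \<Rightarrow> 'a \<Rightarrow> 'a) \<Rightarrow> 'a set \<Rightarrow> ('a \<Rightarrow> complex) \<Rightarrow> 'a \<Rightarrow> bool"
  where "root_vector br \<hh> \<alpha> x \<longleftrightarrow> x \<in> root_space br \<hh> \<alpha> \<and> x \<noteq> 0"

definition invariant_form ::
    "('a::complex_vector \<Rightarrow> 'a \<Rightarrow> 'a) \<Rightarrow> ('a \<Rightarrow> 'a \<Rightarrow> complex) \<Rightarrow> bool"
  where "invariant_form br \<kappa> \<longleftrightarrow> cbilinear \<kappa> \<and> (\<forall>x y. \<kappa> x y = \<kappa> y x) \<and>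
    (\<forall>x y z. \<kappa> (br x y) z = \<kappa> x (br y z)) \<and> (\<forall>x. (\<forall>y. \<kappa> x y = 0) \<longrightarrow> x = 0)"

text \<open>The value \<open>(\<alpha>, \<alpha>)\<close> of the form transported to the dual of \<open>\<hh>\<close>: it is \<open>(t, t)\<close> for the
  \<open>t \<in> \<hh>\<close> that represents \<open>\<alpha>\<close> on \<open>\<hh>\<close>.\<close>

definition dual_form_square ::
    "'a::complex_vector set \<Rightarrow> ('a \<Rightarrow> 'a \<Rightarrow> complex) \<Rightarrow> ('a \<Rightarrow> complex) \<Rightarrow> complex"
  where "dual_form_square \<hh> \<kappa> \<alpha> = (let t = (THE t. t \<in> \<hh> \<and> (\<forall>h\<in>\<hh>. \<kappa> t h = \<alpha> h)) in \<kappa> t t)"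

text \<open>The usual normalization: all \<open>(\<alpha>, \<alpha>)\<close> are real, and their maximum, attained at the long roots,
  is \<open>2\<close>.\<close>

definition normalized_form ::
    "('a::complex_vector \<Rightarrow> 'a \<Rightarrow> 'a) \<Rightarrow> 'a set \<Rightarrow> ('a \<Rightarrow> 'a \<Rightarrow> complex) \<Rightarrow> bool"
  where "normalized_form br \<hh> \<kappa> \<longleftrightarrow> invariant_form br \<kappa> \<and>
    (\<forall>\<alpha>\<in>roots br \<hh>. \<exists>r\<le>2. dual_form_square \<hh> \<kappa> \<alpha> = complex_of_real r) \<and>
    (\<exists>\<theta>\<in>roots br \<hh>. dual_form_square \<hh> \<kappa> \<theta> = 2)"


section \<open>Finitely generated commutative algebras\<close>

class complex_comm_algebra_1 = complex_vector + comm_ring_1 +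
  assumes scaleC_mult_left: "(c *\<^sub>C x) * y = c *\<^sub>C (x * y)"

lemma scaleC_mult_right: "x * (c *\<^sub>C y) = c *\<^sub>C (x * y)"
  for x y :: "'b::complex_comm_algebra_1"
  by (metis mult.commute scaleC_mult_left)

instance complex :: complex_comm_algebra_1
  by standard (simp add: scaleC_complex_def)

instance poly_mapping :: (comm_monoid_add, complex_comm_algebra_1) complex_comm_algebra_1
proof
  fix c :: complex and p q :: "'a \<Rightarrow>\<^sub>0 'b"
  have scale: "d *\<^sub>C r = Poly_Mapping.single 0 (d *\<^sub>C 1) * r" for d and r :: "'a \<Rightarrow>\<^sub>0 'b"
  proof (rule poly_mapping_eqI)
    fix k
    have "Poly_Mapping.lookup (Poly_Mapping.single 0 (d *\<^sub>C 1) * r) k = (d *\<^sub>C 1) * Poly_Mapping.lookup r k"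
      by (simp add: mult_map_scale_conv_mult[symmetric] Poly_Mapping.map.rep_eq when_def)
    then show "Poly_Mapping.lookup (d *\<^sub>C r) k =
        Poly_Mapping.lookup (Poly_Mapping.single 0 (d *\<^sub>C 1) * r) k"
      by (simp add: scaleC_mult_left)
  qed
  show "c *\<^sub>C p * q = c *\<^sub>C (p * q)"
    by (simp add: scale mult.assoc)
qed

definition unital_subalgebra :: "'b::complex_comm_algebra_1 set \<Rightarrow> bool"
  where "unital_subalgebra S \<longleftrightarrow> csubspace S \<and> 1 \<in> S \<and> (\<forall>x\<in>S. \<forall>y\<in>S. x * y \<in> S)"

definition finitely_generated_algebra :: "'b::complex_comm_algebra_1 itself \<Rightarrow> bool"
  where "finitely_generated_algebra _ \<longleftrightarrow>
    (\<exists>F :: 'b set. finite F \<and> (\<forall>S. unital_subalgebra S \<and> F \<subseteq> S \<longrightarrow> S = UNIV))"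


text \<open>The Lie algebra \<open>L \<otimes> B\<close> with \<open>[x \<otimes> b, y \<otimes> b'] = [x, y] \<otimes> b b'\<close>.\<close>

definition current_bracket :: "('a::complex_vector \<Rightarrow> 'a \<Rightarrow> 'a) \<Rightarrow>
    ('a, 'b::complex_comm_algebra_1) tensor \<Rightarrow> ('a, 'b) tensor \<Rightarrow> ('a, 'b) tensor"
  where "current_bracket br = tensor_lift2 (\<lambda>x a y b. br x y \<otimes> (a * b))"

context
  fixes br :: "'a::complex_vector \<Rightarrow> 'a \<Rightarrow> 'a"
  assumes br: "cbilinear br"
begin

private lemma cbilinear_aux:
  fixes a b :: "'b::complex_comm_algebra_1"
  shows "cbilinear (\<lambda>y b. br x y \<otimes> (a * b))" "cbilinear (\<lambda>x a. br x y \<otimes> (a * b))"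
proof -
  have "clinear (br x)" "clinear (\<lambda>x. br x y)" for x y
    using br by (auto simp: cbilinear_def)
  note br_lin = this[THEN clinearD(1)] this[THEN clinearD(4)]
  show "cbilinear (\<lambda>y b. br x y \<otimes> (a * b))" "cbilinear (\<lambda>x a. br x y \<otimes> (a * b))"
    by (intro cbilinearI clinearI;
        simp add: br_lin tensor_add_left tensor_add_right tensor_scale_left tensor_scale_right
          distrib_left distrib_right scaleC_mult_left scaleC_mult_right)+
qed

lemma cbilinear_current_bracket:
  "cbilinear (current_bracket br :: ('a, 'b::complex_comm_algebra_1) tensor \<Rightarrow> _)"
  unfolding current_bracket_def by (intro cbilinear_tensor_lift2 cbilinear_aux)

lemma current_bracket_pure:
  "current_bracket br (x \<otimes> a) (y \<otimes> b) = br x y \<otimes> (a * b)"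
  unfolding current_bracket_def by (intro tensor_lift2_pure cbilinear_aux)

end

lemma cbilinearD:
  assumes "cbilinear f"
  shows "f (x + x') y = f x y + f x' y" "f x (y + y') = f x y + f x y'"
    "f (c *\<^sub>C x) y = c *\<^sub>C f x y" "f x (c *\<^sub>C y) = c *\<^sub>C f x y"
    "f 0 y = 0" "f x 0 = 0" "f (- x) y = - f x y" "f x (- y) = - f x y"
    "f (x - x') y = f x y - f x' y" "f x (y - y') = f x y - f x y'"
proof -
  have "clinear (f x)" "clinear (\<lambda>x. f x y)"
    using assms by (auto simp: cbilinear_def)
  note l = this[THEN clinearD(1)] this[THEN clinearD(2)] this[THEN clinearD(3)]
    this[THEN clinearD(4)] this[THEN clinearD(5)]
  show "f (x + x') y = f x y + f x' y" "f x (y + y') = f x y + f x y'"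
    "f (c *\<^sub>C x) y = c *\<^sub>C f x y" "f x (c *\<^sub>C y) = c *\<^sub>C f x y"
    "f 0 y = 0" "f x 0 = 0" "f (- x) y = - f x y" "f x (- y) = - f x y"
    "f (x - x') y = f x y - f x' y" "f x (y - y') = f x y - f x y'"
    by (simp_all add: l)
qed

lemma lie_algebraD:
  assumes "lie_algebra br"
  shows "cbilinear br" "br x x = 0" "br x y = - br y x"
    "br x (br y z) + br y (br z x) + br z (br x y) = 0"
proof -
  show b: "cbilinear br" and alt: "br x x = 0" for x
    using assms by (auto simp: lie_algebra_def)
  show "br x (br y z) + br y (br z x) + br z (br x y) = 0"
    using assms by (auto simp: lie_algebra_def)
  have "br (x + y) (x + y) = br x x + br y y + (br x y + br y x)"
    by (simp only: cbilinearD[OF b] ac_simps)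
  then have "br x y + br y x = 0"
    by (simp only: alt) simp
  then show "br x y = - br y x"
    by (simp only: eq_neg_iff_add_eq_0)
qed

lemma eq_minus_self_imp_zero:
  fixes x :: "'a::complex_vector"
  assumes "x = - x"
  shows "x = 0"
proof -
  have "2 *\<^sub>C x = x + x"
    by (metis one_add_one scaleC_add_left scaleC_one)
  also have "\<dots> = 0"
    using assms by (simp add: eq_neg_iff_add_eq_0)
  finally show ?thesis
    by (simp add: complex_vector.scale_eq_0_iff)
qed

text \<open>Antisymmetry and cyclic identities for bilinear maps on tensor products.\<close>

lemma tensor_antisymI:
  assumes "cbilinear f" "\<And>x a y b. f (x \<otimes> a) (y \<otimes> b) = - f (y \<otimes> b) (x \<otimes> a)"
  shows "f s t = - f t s"
proof (induction s rule: tensor_induct)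
  case (pure x a)
  show ?case
  proof (induction t rule: tensor_induct)
    case (pure y b)
    show ?case by (fact assms(2))
  next
    case (add t t')
    then show ?case by (simp add: cbilinearD[OF assms(1)])
  qed
next
  case (add s s')
  then show ?case by (simp add: cbilinearD[OF assms(1)])
qed

lemma tensor_cyclicI:
  assumes f: "cbilinear f" and g: "cbilinear g"
    and pure: "\<And>x a y b z c. f (x \<otimes> a) (g (y \<otimes> b) (z \<otimes> c)) + f (y \<otimes> b) (g (z \<otimes> c) (x \<otimes> a)) +
      f (z \<otimes> c) (g (x \<otimes> a) (y \<otimes> b)) = 0"
  shows "f s (g t u) + f t (g u s) + f u (g s t) = 0"
proof -
  define J where "J s t u = f s (g t u) + f t (g u s) + f u (g s t)" for s t u
  have J: "J (s + s') t u = J s t u + J s' t u" "J s (t + t') u = J s t u + J s t' u"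
    "J s t (u + u') = J s t u + J s t u'" for s s' t t' u u'
    unfolding J_def by (simp_all only: cbilinearD(1,2)[OF f] cbilinearD(1,2)[OF g] ac_simps)
  have "J (x \<otimes> a) (y \<otimes> b) u = 0" for x a y b
    by (induction u rule: tensor_induct) (simp_all only: J, simp_all add: pure J_def)
  then have "J (x \<otimes> a) t u = 0" for x a
    by (induction t rule: tensor_induct) (simp_all add: J)
  then have "J s t u = 0"
    by (induction s rule: tensor_induct) (simp_all add: J)
  then show ?thesis
    by (simp add: J_def)
qed

lemma lie_algebra_current:
  assumes "lie_algebra br"
  shows "lie_algebra (current_bracket br :: ('a::complex_vector, 'b::complex_comm_algebra_1) tensor \<Rightarrow> _)"
proof -
  note br = lie_algebraD[OF assms]
  let ?f = "current_bracket br :: ('a, 'b) tensor \<Rightarrow> _"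
  note bil = cbilinear_current_bracket[OF br(1), where 'b = 'b]
  have "?f s t = - ?f t s" for s t
  proof (rule tensor_antisymI[OF bil])
    fix x y :: 'a and a b :: 'b
    have "br x y \<otimes> (a * b) = (- br y x) \<otimes> (a * b)"
      by (metis br(3))
    then show "?f (x \<otimes> a) (y \<otimes> b) = - ?f (y \<otimes> b) (x \<otimes> a)"
      by (simp add: current_bracket_pure[OF br(1)] cbilinearD[OF cbilinear_pure_tensor] mult.commute)
  qed
  then have "?f s s = 0" for s
    by (rule eq_minus_self_imp_zero)
  moreover have "?f s (?f t u) + ?f t (?f u s) + ?f u (?f s t) = 0" for s t u
  proof (rule tensor_cyclicI[OF bil bil])
    fix x y z :: 'a and a b c :: 'b
    have "b * (c * a) = a * (b * c)" "c * (a * b) = a * (b * c)"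
      by (simp_all only: ac_simps)
    then show "?f (x \<otimes> a) (?f (y \<otimes> b) (z \<otimes> c)) + ?f (y \<otimes> b) (?f (z \<otimes> c) (x \<otimes> a)) +
        ?f (z \<otimes> c) (?f (x \<otimes> a) (y \<otimes> b)) = 0"
      by (simp only: current_bracket_pure[OF br(1)] tensor_add_left[symmetric] br(4)
          cbilinearD(5)[OF cbilinear_pure_tensor])
  qed
  ultimately show ?thesis
    using bil by (simp add: lie_algebra_def)
qed


section \<open>Toroidal Lie algebras\<close>

text \<open>The indices \<open>1, \<dots>, n\<close> are the elements of a finite type \<^typ>\<open>'n\<close>, hence \<open>n = CARD('n) \<ge> 1\<close>. The
  indices \<open>0, \<dots>, n\<close> are the elements of \<^typ>\<open>'n option\<close>, with \<^term>\<open>None\<close> for \<open>0\<close>.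
  The basis vector of the Laurent polynomial ring belonging to the exponent \<open>k\<close> is the monomial
  \<open>t\<^sub>0\<^bsup>k\<^sub>0\<^esup> \<dots> t\<^sub>n\<^bsup>k\<^sub>n\<^esup>\<close>.\<close>

type_synonym 'n exponent = "(int, 'n option) vec"
type_synonym 'n laurent = "'n exponent \<Rightarrow>\<^sub>0 complex"
type_synonym 'n Omega = "'n exponent \<times> 'n option \<Rightarrow>\<^sub>0 complex"

abbreviation monomial :: "'n::finite exponent \<Rightarrow> 'n laurent"
  where "monomial k \<equiv> basis_vector k"

text \<open>\<open>basis_vector (k, i)\<close> is \<open>t\<^bsup>k\<^esup> K\<^sub>i\<close>.\<close>

definition dA :: "'n::finite Omega set"
  where "dA = cspan (range (\<lambda>k. \<Sum>i\<in>UNIV. of_int (k $ i) *\<^sub>C basis_vector (k, i)))"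

lemma csubspace_dA: "csubspace dA"
  unfolding dA_def by (rule complex_vector.subspace_span)

quotient_type 'n centre = "'n::finite Omega" / "\<lambda>p q. p - q \<in> dA"
  by (rule equivp_mod_subspace) (rule csubspace_dA)

instantiation centre :: (finite) complex_vector
begin

lift_definition zero_centre :: "'a centre" is 0 .

lift_definition plus_centre :: "'a centre \<Rightarrow> 'a centre \<Rightarrow> 'a centre" is "(+)"
  by (rule mod_subspace(1)[OF csubspace_dA])

lift_definition minus_centre :: "'a centre \<Rightarrow> 'a centre \<Rightarrow> 'a centre" is "(-)"
  by (rule mod_subspace(2)[OF csubspace_dA])

lift_definition uminus_centre :: "'a centre \<Rightarrow> 'a centre" is uminus
  by (rule mod_subspace(3)[OF csubspace_dA])

lift_definition scaleC_centre :: "complex \<Rightarrow> 'a centre \<Rightarrow> 'a centre" is scaleC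
  by (rule mod_subspace(4)[OF csubspace_dA])

instance
  by standard
    (transfer; simp add: algebra_simps scaleC_add_right scaleC_add_left scaleC_scaleC scaleC_one
      complex_vector.subspace_0[OF csubspace_dA])+

end

text \<open>The class of \<open>t\<^bsup>k\<^esup> K\<^sub>i\<close>.\<close>

lift_definition tK :: "'n::finite exponent \<Rightarrow> 'n option \<Rightarrow> 'n centre"
  is "\<lambda>k i. basis_vector (k, i)" .

text \<open>The class of \<open>(da) b\<close>: the bilinear map with
  \<open>(t\<^bsup>k\<^esup>, t\<^bsup>r\<^esup>) \<mapsto> \<Sum>\<^sub>i k\<^sub>i t\<^bsup>k + r\<^esup> K\<^sub>i\<close>.\<close>

definition d_times :: "'n::finite laurent \<Rightarrow> 'n laurent \<Rightarrow> 'n centre"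
  where "d_times a b =
    lin_ext (\<lambda>k. lin_ext (\<lambda>r. \<Sum>i\<in>UNIV. of_int (k $ i) *\<^sub>C tK (k + r) i) b) a"

type_synonym ('g, 'n) tau0 = "('g, 'n laurent) tensor \<times> 'n centre"

text \<open>The derivations: \<open>(complex, 'n option) vec\<close> is the space \<open>D\<close>, with \<open>d\<^sub>i\<close> the \<open>i\<close>-th unit vector.\<close>

type_synonym 'n derivation = "(complex, 'n option) vec"

abbreviation der :: "'n::finite option \<Rightarrow> 'n derivation"
  where "der i \<equiv> axis i 1"

type_synonym ('g, 'n, 'b) tau_loop = "(('g, 'n) tau0, 'b) tensor \<times> 'n derivation"

definition tau0_cocycle :: "('g::complex_vector \<Rightarrow> 'g \<Rightarrow> complex) \<Rightarrow>
    ('g, 'n::finite laurent) tensor \<Rightarrow> ('g, 'n laurent) tensor \<Rightarrow> 'n centre"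
  where "tau0_cocycle \<kappa> = tensor_lift2 (\<lambda>x a y b. \<kappa> x y *\<^sub>C d_times a b)"

definition tau0_bracket ::
    "('g::complex_vector \<Rightarrow> 'g \<Rightarrow> 'g) \<Rightarrow> ('g \<Rightarrow> 'g \<Rightarrow> complex) \<Rightarrow>
      ('g, 'n::finite) tau0 \<Rightarrow> ('g, 'n) tau0 \<Rightarrow> ('g, 'n) tau0"
  where "tau0_bracket br \<kappa> X Y =
    (current_bracket br (fst X) (fst Y),
     tau0_cocycle \<kappa> (fst X) (fst Y))"

text \<open>The eigenvalue of \<open>\<Sum>\<^sub>i c\<^sub>i d\<^sub>i\<close> in degree \<open>k\<close>.\<close>

definition degree_value :: "'n::finite derivation \<Rightarrow> 'n exponent \<Rightarrow> complex"
  where "degree_value c k = (\<Sum>i\<in>UNIV. c $ i * of_int (k $ i))"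

definition der_laurent :: "'n::finite derivation \<Rightarrow> 'n laurent \<Rightarrow> 'n laurent"
  where "der_laurent c = lin_ext (\<lambda>k. degree_value c k *\<^sub>C monomial k)"

definition der_Omega :: "'n::finite derivation \<Rightarrow> 'n Omega \<Rightarrow> 'n Omega"
  where "der_Omega c = lin_ext (\<lambda>(k, j). degree_value c k *\<^sub>C basis_vector (k, j))"

lemma der_Omega_dA:
  assumes "p \<in> dA"
  shows "der_Omega c p \<in> dA"
  using assms unfolding dA_def
proof (induction rule: complex_vector.span_induct_alt)
  case base
  show ?case
    by (simp add: der_Omega_def clinearD[OF clinear_lin_ext] complex_vector.span_zero)
next
  case (step a x y)
  then obtain k where x: "x = (\<Sum>i\<in>UNIV. of_int (k $ i) *\<^sub>C basis_vector (k, i))"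
    by auto
  have "der_Omega c x = degree_value c k *\<^sub>C x"
    unfolding x der_Omega_def
    by (simp add: clinearD[OF clinear_lin_ext] complex_vector.scale_sum_right scaleC_scaleC mult.commute)
  moreover have "der_Omega c (a *\<^sub>C x + y) = a *\<^sub>C der_Omega c x + der_Omega c y"
    by (simp add: der_Omega_def clinearD[OF clinear_lin_ext])
  ultimately show ?case
    using step by (simp add: complex_vector.span_add complex_vector.span_scale complex_vector.span_base)
qed

lift_definition der_centre :: "'n::finite derivation \<Rightarrow> 'n centre \<Rightarrow> 'n centre" is der_Omega
proof -
  fix c :: "'n derivation" and p q :: "'n Omega"
  assume "p - q \<in> dA"
  then have "der_Omega c (p - q) \<in> dA"
    by (rule der_Omega_dA)
  then show "der_Omega c p - der_Omega c q \<in> dA"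
    by (simp only: der_Omega_def clinearD(2)[OF clinear_lin_ext])
qed

definition der_loop :: "'n::finite derivation \<Rightarrow> ('g::complex_vector, 'n laurent) tensor \<Rightarrow>
    ('g, 'n laurent) tensor"
  where "der_loop c = tensor_lift (\<lambda>x a. x \<otimes> der_laurent c a)"

definition der_tau0 ::
    "'n::finite derivation \<Rightarrow> ('g::complex_vector, 'n) tau0 \<Rightarrow> ('g, 'n) tau0"
  where "der_tau0 c X = (der_loop c (fst X), der_centre c (snd X))"

definition der_tau0_loop ::
    "'n::finite derivation \<Rightarrow> (('g::complex_vector, 'n) tau0, 'b::complex_vector) tensor \<Rightarrow>
      (('g, 'n) tau0, 'b) tensor"
  where "der_tau0_loop c = tensor_lift (\<lambda>X b. der_tau0 c X \<otimes> b)"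

definition tau_loop_bracket ::
    "('g::complex_vector \<Rightarrow> 'g \<Rightarrow> 'g) \<Rightarrow> ('g \<Rightarrow> 'g \<Rightarrow> complex) \<Rightarrow>
      ('g, 'n::finite, 'b::complex_comm_algebra_1) tau_loop \<Rightarrow> ('g, 'n, 'b) tau_loop \<Rightarrow>
      ('g, 'n, 'b) tau_loop"
  where "tau_loop_bracket br \<kappa> U V =
    (current_bracket (tau0_bracket br \<kappa>) (fst U) (fst V)
       + der_tau0_loop (snd U) (fst V) - der_tau0_loop (snd V) (fst U), 0)"


definition loop_elem :: "'g::complex_vector \<Rightarrow> 'n::finite exponent \<Rightarrow> 'b::complex_comm_algebra_1 \<Rightarrow>
    ('g, 'n, 'b) tau_loop"
  where "loop_elem x k b = ((x \<otimes> monomial k, 0) \<otimes> b, 0)"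

definition central_elem :: "'n::finite exponent \<Rightarrow> 'n option \<Rightarrow> 'b::complex_comm_algebra_1 \<Rightarrow>
    ('g::complex_vector, 'n, 'b) tau_loop"
  where "central_elem k i b = ((0, tK k i) \<otimes> b, 0)"

definition der_elem :: "'n::finite option \<Rightarrow>
    ('g::complex_vector, 'n, 'b::complex_comm_algebra_1) tau_loop"
  where "der_elem i = (0, der i)"

lemma clinear_abs_centre: "clinear abs_centre"
  by (rule clinearI) (simp_all add: plus_centre.abs_eq scaleC_centre.abs_eq)

lemma tK_relation: "(\<Sum>i\<in>UNIV. of_int (k $ i) *\<^sub>C tK k i) = 0"
proof -
  let ?p = "\<Sum>i\<in>UNIV. of_int (k $ i) *\<^sub>C basis_vector (k, i)"
  have "?p - 0 \<in> dA"
    unfolding dA_def by (simp add: complex_vector.span_base)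
  then have "abs_centre ?p = 0"
    unfolding zero_centre.abs_eq by (subst centre.abs_eq_iff)
  then show ?thesis
    by (simp add: clinearD[OF clinear_abs_centre] tK.abs_eq)
qed

lemma centre_induct [case_names basis scale add]:
  assumes basis: "\<And>k i. P (tK k i)" and scale: "\<And>c z. P z \<Longrightarrow> P (c *\<^sub>C z)"
    and add: "\<And>z z'. P z \<Longrightarrow> P z' \<Longrightarrow> P (z + z')"
  shows "P z"
proof -
  have "P (abs_centre p)" for p
  proof (induction p rule: free_induct)
    case (basis ki)
    show ?case
      using assms(1)[of "fst ki" "snd ki"] by (simp add: tK.abs_eq)
  qed (simp_all add: clinearD[OF clinear_abs_centre] scale add)
  then show ?thesis
    by (metis Quotient3_abs_rep[OF Quotient3_centre])
qed

lemma cbilinear_d_times: "cbilinear d_times"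
proof (rule cbilinearI)
  show "clinear (d_times a)" for a :: "'a laurent"
    unfolding d_times_def
    by (rule clinearI) (simp_all add: clinearD[OF clinear_lin_ext] lin_ext_fun)
  show "clinear (\<lambda>a. d_times a b)" for b :: "'a laurent"
    unfolding d_times_def by (rule clinear_lin_ext)
qed

lemma d_times_monomial:
  "d_times (monomial k) (monomial r) = (\<Sum>i\<in>UNIV. of_int (k $ i) *\<^sub>C tK (k + r) i)"
  by (simp add: d_times_def)

lemma monomial_mult: "monomial k * monomial r = monomial (k + r)"
  by (simp add: mult_single)

lemmas d_times_lin = cbilinearD[OF cbilinear_d_times]

lemma d_times_antisym: "d_times a b = - d_times b a"
proof (induction a rule: free_induct)
  case (basis k)
  show ?case
  proof (induction b rule: free_induct)
    case (basis r)
    have "d_times (monomial k) (monomial r) + d_times (monomial r) (monomial k) = 0"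
      using tK_relation[of "k + r"]
      by (simp add: d_times_monomial add.commute[of r] sum.distrib scaleC_add_left)
    then show ?case
      by (simp add: eq_neg_iff_add_eq_0)
  qed (simp_all add: d_times_lin)
qed (simp_all add: d_times_lin)

lemma d_times_cyclic: "d_times a (b * c) + d_times b (c * a) + d_times c (a * b) = 0"
proof -
  define J where "J a b c = d_times a (b * c) + d_times b (c * a) + d_times c (a * b)"
    for a b c :: "'a laurent"
  have lin: "J (a + a') b c = J a b c + J a' b c" "J a (b + b') c = J a b c + J a b' c"
    "J a b (c + c') = J a b c + J a b c'" "J (x *\<^sub>C a) b c = x *\<^sub>C J a b c"
    "J a (x *\<^sub>C b) c = x *\<^sub>C J a b c" "J a b (x *\<^sub>C c) = x *\<^sub>C J a b c" for a a' b b' c c' x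
    by (simp_all add: J_def d_times_lin scaleC_mult_left scaleC_mult_right distrib_left distrib_right
        scaleC_add_right ac_simps)
  have J_basis: "J (monomial k) (monomial r) (monomial s) = 0" for k r s
    using tK_relation[of "k + r + s"]
    by (simp add: J_def monomial_mult d_times_monomial ac_simps sum.distrib scaleC_add_left)
  have J1: "J (monomial k) (monomial r) c = 0" for k r
    by (induction c rule: free_induct) (simp_all add: lin J_basis)
  have J2: "J (monomial k) b c = 0" for k
    by (induction b rule: free_induct) (simp_all add: lin J1)
  have "J a b c = 0"
    by (induction a rule: free_induct) (simp_all add: lin J2)
  then show ?thesis
    by (simp add: J_def)
qed

context
  fixes \<kappa> :: "'g::complex_vector \<Rightarrow> 'g \<Rightarrow> complex"
  assumes \<kappa>: "cbilinear \<kappa>"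
begin

private lemma cocycle_aux:
  "cbilinear (\<lambda>y b. \<kappa> x y *\<^sub>C d_times a b)" "cbilinear (\<lambda>x a. \<kappa> x y *\<^sub>C d_times a b)"
  by (intro cbilinearI clinearI;
      simp add: cbilinearD[OF \<kappa>] d_times_lin scaleC_add_left scaleC_add_right scaleC_scaleC
        scaleC_complex_def mult.commute)+

lemma cbilinear_tau0_cocycle: "cbilinear (tau0_cocycle \<kappa> :: ('g, 'n::finite laurent) tensor \<Rightarrow> _)"
  unfolding tau0_cocycle_def by (intro cbilinear_tensor_lift2 cocycle_aux)

lemma tau0_cocycle_pure: "tau0_cocycle \<kappa> (x \<otimes> a) (y \<otimes> b) = \<kappa> x y *\<^sub>C d_times a b"
  unfolding tau0_cocycle_def by (intro tensor_lift2_pure cocycle_aux)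

end

lemma cbilinear_tau0_bracket:
  assumes "cbilinear br" "cbilinear \<kappa>"
  shows "cbilinear (tau0_bracket br \<kappa> :: ('g::complex_vector, 'n::finite) tau0 \<Rightarrow> _)"
  unfolding tau0_bracket_def
  by (intro cbilinearI clinearI; simp add: scaleC_prod_def
      cbilinearD[OF cbilinear_current_bracket[OF assms(1)]]
      cbilinearD[OF cbilinear_tau0_cocycle[OF assms(2)]])

lemma lie_algebra_tau0:
  assumes "lie_algebra br" "invariant_form br \<kappa>"
  shows "lie_algebra (tau0_bracket br \<kappa> :: ('g::complex_vector, 'n::finite) tau0 \<Rightarrow> _)"
proof -
  note br = lie_algebraD[OF assms(1)]
  note cur = lie_algebraD[OF lie_algebra_current[OF assms(1), where 'b = "'n laurent"]]
  have \<kappa>: "cbilinear \<kappa>" and sym: "\<kappa> x y = \<kappa> y x" and inv: "\<kappa> (br x y) z = \<kappa> x (br y z)" for x y z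
    using assms(2) unfolding invariant_form_def by blast+
  let ?\<psi> = "tau0_cocycle \<kappa> :: ('g, 'n laurent) tensor \<Rightarrow> _"
  let ?c = "current_bracket br :: ('g, 'n laurent) tensor \<Rightarrow> _"
  note bil = cbilinear_tau0_cocycle[OF \<kappa>, where 'n = 'n]
  have "?\<psi> s t = - ?\<psi> t s" for s t
  proof (rule tensor_antisymI[OF bil])
    fix x y :: 'g and a b :: "'n laurent"
    have "\<kappa> x y *\<^sub>C d_times a b = \<kappa> y x *\<^sub>C (- d_times b a)"
      by (metis d_times_antisym sym)
    then show "?\<psi> (x \<otimes> a) (y \<otimes> b) = - ?\<psi> (y \<otimes> b) (x \<otimes> a)"
      by (simp add: tau0_cocycle_pure[OF \<kappa>])
  qed
  then have alt: "?\<psi> s s = 0" for s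
    by (rule eq_minus_self_imp_zero)
  have cyc: "?\<psi> s (?c t u) + ?\<psi> t (?c u s) + ?\<psi> u (?c s t) = 0" for s t u
  proof (rule tensor_cyclicI[OF bil cbilinear_current_bracket[OF br(1)]])
    fix x y z :: 'g and a b c :: "'n laurent"
    have "\<kappa> y (br z x) = \<kappa> x (br y z)" "\<kappa> z (br x y) = \<kappa> x (br y z)"
      by (metis inv sym)+
    then show "?\<psi> (x \<otimes> a) (?c (y \<otimes> b) (z \<otimes> c)) + ?\<psi> (y \<otimes> b) (?c (z \<otimes> c) (x \<otimes> a)) +
        ?\<psi> (z \<otimes> c) (?c (x \<otimes> a) (y \<otimes> b)) = 0"
      by (simp add: tau0_cocycle_pure[OF \<kappa>] current_bracket_pure[OF br(1)]
          scaleC_add_right[symmetric] d_times_cyclic)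
  qed
  show ?thesis
    unfolding lie_algebra_def
    using cbilinear_tau0_bracket[OF br(1) \<kappa>, where 'n = 'n]
    by (simp add: tau0_bracket_def alt cyc cur(2,4) zero_prod_def)
qed

subsection \<open>The derivations\<close>

lemma degree_value_add: "degree_value c (k + r) = degree_value c k + degree_value c r"
  by (simp add: degree_value_def sum.distrib distrib_left)

lemma degree_value_lin:
  "degree_value (c + c') k = degree_value c k + degree_value c' k"
  "degree_value (x *\<^sub>C c) k = x * degree_value c k"
  by (simp_all add: degree_value_def scaleC_vec_def scaleC_complex_def sum.distrib distrib_right
      sum_distrib_left mult.assoc)

lemma degree_value_der: "degree_value (der i) k = of_int (k $ i)"
  by (simp add: degree_value_def axis_def if_distrib[of "\<lambda>x. x * _"] cong: if_cong)

lemma der_laurent_monomial: "der_laurent c (monomial k) = degree_value c k *\<^sub>C monomial k"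
  by (simp add: der_laurent_def)

lemma clinear_der_laurent: "clinear (der_laurent c)"
  unfolding der_laurent_def by (rule clinear_lin_ext)

lemma der_laurent_lin_left:
  "der_laurent (c + c') a = der_laurent c a + der_laurent c' a"
  "der_laurent (x *\<^sub>C c) a = x *\<^sub>C der_laurent c a"
  by (simp_all add: der_laurent_def lin_ext_def degree_value_lin scaleC_add_left scaleC_add_right
      sum.distrib complex_vector.scale_sum_right scaleC_scaleC ac_simps)

lemma cbilinear_der_laurent: "cbilinear der_laurent"
  by (intro cbilinearI clinear_der_laurent clinearI der_laurent_lin_left)

lemma der_centre_tK: "der_centre c (tK k i) = degree_value c k *\<^sub>C tK k i"
  by (simp add: tK.abs_eq der_centre.abs_eq der_Omega_def clinearD[OF clinear_abs_centre])

lemma clinear_der_centre: "clinear (der_centre c)"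
proof (rule clinearI)
  show "der_centre c (z + z') = der_centre c z + der_centre c z'" for z z'
    by transfer (simp add: der_Omega_def clinearD[OF clinear_lin_ext] dA_def complex_vector.span_zero)
  show "der_centre c (x *\<^sub>C z) = x *\<^sub>C der_centre c z" for x z
    by transfer (simp add: der_Omega_def clinearD[OF clinear_lin_ext] dA_def complex_vector.span_zero)
qed

lemma cbilinear_der_centre: "cbilinear der_centre"
proof (intro cbilinearI clinear_der_centre clinearI)
  show "der_centre (c + c') z = der_centre c z + der_centre c' z" for c c' and z :: "'a centre"
    by (induction z rule: centre_induct)
      (simp_all add: der_centre_tK clinearD[OF clinear_der_centre] degree_value_lin scaleC_add_left
        scaleC_add_right ac_simps)
  show "der_centre (x *\<^sub>C c) z = x *\<^sub>C der_centre c z" for x c and z :: "'a centre"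
    by (induction z rule: centre_induct)
      (simp_all add: der_centre_tK clinearD[OF clinear_der_centre] degree_value_lin
        scaleC_add_right scaleC_scaleC ac_simps)
qed

lemmas der_lin = cbilinearD[OF cbilinear_der_laurent] cbilinearD[OF cbilinear_der_centre]

lemma der_laurent_mult: "der_laurent c (a * b) = der_laurent c a * b + a * der_laurent c b"
proof (induction a rule: free_induct)
  case (basis k)
  show ?case
  proof (induction b rule: free_induct)
    case (basis r)
    show ?case
      by (simp add: der_laurent_monomial monomial_mult scaleC_mult_left scaleC_mult_right
          degree_value_add scaleC_add_left)
  next
    case (scale x p)
    then show ?case
      by (simp add: der_lin scaleC_mult_right scaleC_add_right)
  next
    case (add p q)
    then show ?case
      by (simp only: der_lin distrib_left distrib_right ac_simps)
  qed
next
  case (scale x p)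
  then show ?case
    by (simp add: der_lin scaleC_mult_left scaleC_add_right)
next
  case (add p q)
  then show ?case
    by (simp only: der_lin distrib_left distrib_right ac_simps)
qed

lemma der_centre_d_times:
  "der_centre c (d_times a b) = d_times (der_laurent c a) b + d_times a (der_laurent c b)"
proof (induction a rule: free_induct)
  case (basis k)
  show ?case
  proof (induction b rule: free_induct)
    case (basis r)
    show ?case
      by (simp add: der_laurent_monomial d_times_lin d_times_monomial
          clinearD[OF clinear_der_centre] der_centre_tK degree_value_add scaleC_add_left
          complex_vector.scale_sum_right scaleC_scaleC scaleC_add_right sum.distrib mult.commute)
  qed (simp_all add: der_lin d_times_lin scaleC_add_right ac_simps)
qed (simp_all add: der_lin d_times_lin scaleC_add_right ac_simps)

lemma der_laurent_commute: "der_laurent c (der_laurent c' a) = der_laurent c' (der_laurent c a)"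
  by (induction a rule: free_induct)
    (simp_all add: der_laurent_monomial der_lin scaleC_scaleC mult.commute)

lemma der_centre_commute: "der_centre c (der_centre c' z) = der_centre c' (der_centre c z)"
  by (induction z rule: centre_induct) (simp_all add: der_centre_tK der_lin scaleC_scaleC mult.commute)

text \<open>A linear family \<open>D\<close> of linear maps acting on the second, respectively first, tensor factor.\<close>

context
  fixes D :: "'c::complex_vector \<Rightarrow> 'd::complex_vector \<Rightarrow> 'd"
  assumes D: "cbilinear D"
begin

lemma der_tensor_aux: "cbilinear (\<lambda>x a. x \<otimes> D c a)" "cbilinear (\<lambda>x b. D c x \<otimes> b)"
  by (intro cbilinearI clinearI;
      simp only: cbilinearD(1-4)[OF D] tensor_add_left tensor_add_right tensor_scale_left
        tensor_scale_right)+

lemma cbilinear_der_tensor_right: "cbilinear (\<lambda>c. tensor_lift (\<lambda>(x::'a::complex_vector) a. x \<otimes> D c a))"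
proof (rule cbilinearI, rule clinear_tensor_lift, rule der_tensor_aux, rule clinearI)
  note t = clinearD[OF clinear_tensor_lift[OF der_tensor_aux(1)]]
  note p = tensor_lift_pure[OF der_tensor_aux(1)]
  fix s :: "('a, 'd) tensor" and c c' :: 'c and x :: complex
  let ?T = "\<lambda>c. tensor_lift (\<lambda>(x::'a) a. x \<otimes> D c a)"
  show "?T (c + c') s = ?T c s + ?T c' s"
  proof (induction s rule: tensor_induct)
    case (pure y a)
    show ?case by (simp only: p) (simp only: cbilinearD[OF D] tensor_add_right)
  next
    case (add s s')
    then show ?case by (simp only: t ac_simps)
  qed
  show "?T (x *\<^sub>C c) s = x *\<^sub>C ?T c s"
  proof (induction s rule: tensor_induct)
    case (pure y a)
    show ?case by (simp only: p) (simp only: cbilinearD[OF D] tensor_scale_right)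
  next
    case (add s s')
    then show ?case by (simp only: t scaleC_add_right)
  qed
qed

lemma cbilinear_der_tensor_left: "cbilinear (\<lambda>c. tensor_lift (\<lambda>x (b::'b::complex_vector). D c x \<otimes> b))"
proof (rule cbilinearI, rule clinear_tensor_lift, rule der_tensor_aux, rule clinearI)
  note t = clinearD[OF clinear_tensor_lift[OF der_tensor_aux(2)]]
  note p = tensor_lift_pure[OF der_tensor_aux(2)]
  fix s :: "('d, 'b) tensor" and c c' :: 'c and x :: complex
  let ?T = "\<lambda>c. tensor_lift (\<lambda>x (b::'b). D c x \<otimes> b)"
  show "?T (c + c') s = ?T c s + ?T c' s"
  proof (induction s rule: tensor_induct)
    case (pure y a)
    show ?case by (simp only: p) (simp only: cbilinearD[OF D] tensor_add_left)
  next
    case (add s s')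
    then show ?case by (simp only: t ac_simps)
  qed
  show "?T (x *\<^sub>C c) s = x *\<^sub>C ?T c s"
  proof (induction s rule: tensor_induct)
    case (pure y a)
    show ?case by (simp only: p) (simp only: cbilinearD[OF D] tensor_scale_left)
  next
    case (add s s')
    then show ?case by (simp only: t scaleC_add_right)
  qed
qed

end

lemma tensor_map_eqI:
  assumes "cbilinear f" "cbilinear g" "cbilinear h"
    and "\<And>x a y b. d (f (x \<otimes> a) (y \<otimes> b)) = g (d' (x \<otimes> a)) (y \<otimes> b) + h (x \<otimes> a) (d' (y \<otimes> b))"
    and "clinear d" "clinear d'"
  shows "d (f s t) = g (d' s) t + h s (d' t)"
proof -
  note l = cbilinearD[OF assms(1)] cbilinearD[OF assms(2)] cbilinearD[OF assms(3)]
    clinearD[OF assms(5)] clinearD[OF assms(6)]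
  have "d (f (x \<otimes> a) t) = g (d' (x \<otimes> a)) t + h (x \<otimes> a) (d' t)" for x a
    by (induction t rule: tensor_induct) (simp_all only: l assms(4) ac_simps)
  then show ?thesis
    by (induction s rule: tensor_induct) (simp_all only: l ac_simps)
qed

lemmas cbilinear_der_loop = cbilinear_der_tensor_right[OF cbilinear_der_laurent, folded der_loop_def]
lemmas der_loop_pure =
  tensor_lift_pure[OF der_tensor_aux(1)[OF cbilinear_der_laurent], folded der_loop_def]

lemma der_loop_commute: "der_loop c (der_loop c' s) = der_loop c' (der_loop c s)"
  by (induction s rule: tensor_induct)
    (simp_all only: der_loop_pure der_laurent_commute[of c c'] cbilinearD[OF cbilinear_der_loop])

lemma cbilinear_der_tau0: "cbilinear (der_tau0 :: _ \<Rightarrow> ('g::complex_vector, 'n::finite) tau0 \<Rightarrow> _)"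
  unfolding der_tau0_def
  by (intro cbilinearI clinearI; simp add: scaleC_prod_def cbilinearD[OF cbilinear_der_loop] der_lin)

lemma der_tau0_commute: "der_tau0 c (der_tau0 c' X) = der_tau0 c' (der_tau0 c X)"
  by (simp add: der_tau0_def der_loop_commute[of c c'] der_centre_commute[of c c'])

lemma der_tau0_bracket:
  assumes "cbilinear br" "cbilinear \<kappa>"
  shows "der_tau0 c (tau0_bracket br \<kappa> X Y) =
    tau0_bracket br \<kappa> (der_tau0 c X) Y + tau0_bracket br \<kappa> X (der_tau0 c Y)"
proof -
  note cur = current_bracket_pure[OF assms(1)] and coc = tau0_cocycle_pure[OF assms(2)]
  note bil = cbilinear_current_bracket[OF assms(1)] cbilinear_tau0_cocycle[OF assms(2)]
  note lin = clinear_tensor_lift[OF der_tensor_aux(1)[OF cbilinear_der_laurent], folded der_loop_def]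
  have "der_loop c (current_bracket br s t) =
      current_bracket br (der_loop c s) t + current_bracket br s (der_loop c t)" for s t
    by (rule tensor_map_eqI[OF bil(1) bil(1) bil(1) _ lin lin])
      (simp only: cur der_loop_pure der_laurent_mult tensor_add_right)
  moreover have "der_centre c (tau0_cocycle \<kappa> s t) =
      tau0_cocycle \<kappa> (der_loop c s) t + tau0_cocycle \<kappa> s (der_loop c t)" for s t
    by (rule tensor_map_eqI[OF bil(2) bil(2) bil(2) _ clinear_der_centre lin])
      (simp only: coc der_loop_pure der_lin der_centre_d_times scaleC_add_right)
  ultimately show ?thesis
    by (simp add: tau0_bracket_def der_tau0_def)
qed

lemmas cbilinear_der_tau0_loop =
  cbilinear_der_tensor_left[OF cbilinear_der_tau0, folded der_tau0_loop_def]
lemmas der_tau0_loop_pure =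
  tensor_lift_pure[OF der_tensor_aux(2)[OF cbilinear_der_tau0], folded der_tau0_loop_def]

lemma der_tau0_loop_commute: "der_tau0_loop c (der_tau0_loop c' s) = der_tau0_loop c' (der_tau0_loop c s)"
  by (induction s rule: tensor_induct)
    (simp_all only: der_tau0_loop_pure der_tau0_commute[of c c'] cbilinearD[OF cbilinear_der_tau0_loop])

lemma der_tau0_loop_bracket:
  assumes "cbilinear br" "cbilinear \<kappa>"
  shows "der_tau0_loop c (current_bracket (tau0_bracket br \<kappa>) s t) =
    current_bracket (tau0_bracket br \<kappa>) (der_tau0_loop c s) t +
    current_bracket (tau0_bracket br \<kappa>) s (der_tau0_loop c t)"
proof -
  note b = cbilinear_tau0_bracket[OF assms]
  note bil = cbilinear_current_bracket[OF b]
  note lin = clinear_tensor_lift[OF der_tensor_aux(2)[OF cbilinear_der_tau0], folded der_tau0_loop_def]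
  show ?thesis
    by (rule tensor_map_eqI[OF bil bil bil _ lin lin])
      (simp only: current_bracket_pure[OF b] der_tau0_loop_pure der_tau0_bracket[OF assms] tensor_add_left)
qed

lemma cbilinear_tau_loop_bracket:
  assumes "cbilinear br" "cbilinear \<kappa>"
  shows "cbilinear (tau_loop_bracket br \<kappa> ::
    ('g::complex_vector, 'n::finite, 'b::complex_comm_algebra_1) tau_loop \<Rightarrow> _)"
  unfolding tau_loop_bracket_def
  by (intro cbilinearI clinearI; simp add: scaleC_prod_def
      cbilinearD[OF cbilinear_current_bracket[OF cbilinear_tau0_bracket[OF assms]]]
      cbilinearD[OF cbilinear_der_tau0_loop] complex_vector.scale_right_diff_distrib
      scaleC_add_right)

lemma tau_loop_bracket_simps:
  fixes br :: "'g::complex_vector \<Rightarrow> 'g \<Rightarrow> 'g"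
    and x y :: 'g and k r :: "'n::finite exponent" and b b' :: "'b::complex_comm_algebra_1"
  assumes br: "cbilinear br" and \<kappa>: "cbilinear \<kappa>"
  shows
    "tau_loop_bracket br \<kappa> (loop_elem x k b) (loop_elem y r b') = loop_elem (br x y) (k + r) (b * b') +
      \<kappa> x y *\<^sub>C (\<Sum>i\<in>UNIV. of_int (k $ i) *\<^sub>C central_elem (k + r) i (b * b'))"
    "tau_loop_bracket br \<kappa> (central_elem k i b) (loop_elem y r b') = 0"
    "tau_loop_bracket br \<kappa> (loop_elem x k b) (central_elem r j b') = 0"
    "tau_loop_bracket br \<kappa> (central_elem k i b) (central_elem r j b') = 0"
    "tau_loop_bracket br \<kappa> (der_elem i) (loop_elem y r b') = of_int (r $ i) *\<^sub>C loop_elem y r b'"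
    "tau_loop_bracket br \<kappa> (der_elem i) (central_elem r j b') = of_int (r $ i) *\<^sub>C central_elem r j b'"
    "tau_loop_bracket br \<kappa> (der_elem i) (der_elem j :: ('g, 'n, 'b) tau_loop) = 0"
proof -
  note c = current_bracket_pure[OF cbilinear_tau0_bracket[OF br \<kappa>]]
  note l = cbilinearD[OF cbilinear_current_bracket[OF cbilinear_tau0_bracket[OF br \<kappa>]]]
    cbilinearD[OF cbilinear_der_tau0_loop]
  note defs = tau_loop_bracket_def loop_elem_def central_elem_def der_elem_def
  note t = tau0_bracket_def cbilinearD[OF cbilinear_current_bracket[OF br]]
    cbilinearD[OF cbilinear_tau0_cocycle[OF \<kappa>]] current_bracket_pure[OF br] tau0_cocycle_pure[OF \<kappa>]
  note z = cbilinearD[OF cbilinear_pure_tensor] zero_prod_def[symmetric]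
  have sum_inl: "(\<Sum>i\<in>I. (f i, 0 :: 'n derivation)) = (\<Sum>i\<in>I. f i, 0)"
    for I :: "'n option set" and f :: "_ \<Rightarrow> (('g, 'n) tau0, 'b) tensor"
    by (simp add: prod_eq_iff fst_sum snd_sum)
  have sum_inr: "(0 :: ('g, 'n laurent) tensor, \<Sum>i\<in>I. f i) = (\<Sum>i\<in>I. (0, f i))"
    for I :: "'n option set" and f :: "_ \<Rightarrow> 'n centre"
    by (simp add: prod_eq_iff fst_sum snd_sum)
  have "tau0_bracket br \<kappa> (x \<otimes> monomial k, 0) (y \<otimes> monomial r, 0) =
      (br x y \<otimes> monomial (k + r), 0) +
      \<kappa> x y *\<^sub>C (\<Sum>i\<in>UNIV. of_int (k $ i) *\<^sub>C (0, tK (k + r) i))"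
    by (simp add: t d_times_monomial monomial_mult scaleC_prod_def prod_eq_iff fst_sum snd_sum)
  then have "current_bracket (tau0_bracket br \<kappa>) ((x \<otimes> monomial k, 0) \<otimes> b) ((y \<otimes> monomial r, 0) \<otimes> b') =
      (br x y \<otimes> monomial (k + r), 0) \<otimes> (b * b') +
      \<kappa> x y *\<^sub>C (\<Sum>i\<in>UNIV. of_int (k $ i) *\<^sub>C ((0, tK (k + r) i) \<otimes> (b * b')))"
    by (simp only: c tensor_add_left tensor_scale_left tensor_sum_left)
  then show
    "tau_loop_bracket br \<kappa> (loop_elem x k b) (loop_elem y r b') = loop_elem (br x y) (k + r) (b * b') +
      \<kappa> x y *\<^sub>C (\<Sum>i\<in>UNIV. of_int (k $ i) *\<^sub>C central_elem (k + r) i (b * b'))"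
    by (simp add: defs l scaleC_prod_def sum_inl)
  show
    "tau_loop_bracket br \<kappa> (central_elem k i b) (loop_elem y r b') = 0"
    "tau_loop_bracket br \<kappa> (loop_elem x k b) (central_elem r j b') = 0"
    "tau_loop_bracket br \<kappa> (central_elem k i b) (central_elem r j b') = 0"
    by (simp_all add: defs c l t z)
  have der1: "der_tau0 (der i) (y \<otimes> monomial r, 0) = of_int (r $ i) *\<^sub>C (y \<otimes> monomial r, 0)"
    by (simp add: der_tau0_def der_loop_pure der_lin der_laurent_monomial degree_value_der
        scaleC_prod_def tensor_scale_right)
  have der2: "der_tau0 (der i) (0 :: ('g, 'n laurent) tensor, tK r j) = of_int (r $ i) *\<^sub>C (0, tK r j)"
    by (simp add: der_tau0_def der_centre_tK degree_value_der scaleC_prod_def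
        cbilinearD[OF cbilinear_der_loop])
  show
    "tau_loop_bracket br \<kappa> (der_elem i) (loop_elem y r b') = of_int (r $ i) *\<^sub>C loop_elem y r b'"
    "tau_loop_bracket br \<kappa> (der_elem i) (central_elem r j b') = of_int (r $ i) *\<^sub>C central_elem r j b'"
    "tau_loop_bracket br \<kappa> (der_elem i) (der_elem j :: ('g, 'n, 'b) tau_loop) = 0"
    by (simp_all add: defs l der1 der2 der_tau0_loop_pure tensor_scale_left)
      (simp_all add: scaleC_prod_def zero_prod_def)
qed

lemma lie_algebra_tau_loop:
  assumes "lie_algebra br" "invariant_form br \<kappa>"
  shows "lie_algebra (tau_loop_bracket br \<kappa> ::
    ('g::complex_vector, 'n::finite, 'b::complex_comm_algebra_1) tau_loop \<Rightarrow> _)"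
proof -
  have \<kappa>: "cbilinear \<kappa>"
    using assms(2) by (simp add: invariant_form_def)
  note br = lie_algebraD(1)[OF assms(1)]
  note cur = lie_algebraD[OF lie_algebra_current[OF lie_algebra_tau0[OF assms], where 'b = 'b]]
  note l = cbilinearD[OF cur(1)] cbilinearD[OF cbilinear_der_tau0_loop]
    der_tau0_loop_bracket[OF br \<kappa>]
  let ?f = "tau_loop_bracket br \<kappa> :: ('g, 'n, 'b) tau_loop \<Rightarrow> _"
  have "?f U U = 0" for U
    by (simp add: tau_loop_bracket_def cur(2) zero_prod_def)
  moreover have "?f U (?f V W) + ?f V (?f W U) + ?f W (?f U V) = 0" for U V W
  proof -
    obtain u d v e w f where [simp]: "U = (u, d)" "V = (v, e)" "W = (w, f)"
      by (metis surj_pair)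
    let ?c = "current_bracket (tau0_bracket br \<kappa>) :: (('g, 'n) tau0, 'b) tensor \<Rightarrow> _"
    let ?d = "der_tau0_loop :: 'n derivation \<Rightarrow> (('g, 'n) tau0, 'b) tensor \<Rightarrow> _"
    have comm: "?d e (?d d w) = ?d d (?d e w)" "?d f (?d d v) = ?d d (?d f v)"
      "?d f (?d e u) = ?d e (?d f u)"
      by (fact der_tau0_loop_commute)+
    have anti: "?c (?d e w) u = - ?c u (?d e w)" "?c (?d d v) w = - ?c w (?d d v)"
      "?c (?d f u) v = - ?c v (?d f u)"
      by (fact cur(3))+
    have jac: "?c w (?c u v) = - ?c u (?c v w) - ?c v (?c w u)"
      using cur(4)[of u v w] by (simp add: eq_diff_eq eq_neg_iff_add_eq_0 ac_simps)
    show ?thesis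
      by (simp add: tau_loop_bracket_def zero_prod_def l comm anti jac)
  qed
  ultimately show ?thesis
    using cbilinear_tau_loop_bracket[OF br \<kappa>] by (auto simp: lie_algebra_def)
qed

definition toroidal_cartan :: "'g::complex_vector set \<Rightarrow>
    ('g, 'n::finite, 'b::complex_comm_algebra_1) tau_loop set"
  where "toroidal_cartan \<hh> = cspan ((\<lambda>h. loop_elem h 0 1) ` \<hh> \<union> range (\<lambda>i. central_elem 0 i 1) \<union>
    range der_elem)"


section \<open>Integrable modules\<close>

definition weight_space ::
    "'a set \<Rightarrow> ('a \<Rightarrow> 'v::complex_vector \<Rightarrow> 'v) \<Rightarrow> ('a \<Rightarrow> complex) \<Rightarrow> 'v set"
  where "weight_space H \<rho> \<mu> = {v. \<forall>h\<in>H. \<rho> h v = \<mu> h *\<^sub>C v}"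

definition weight_module :: "'a::complex_vector set \<Rightarrow> ('a \<Rightarrow> 'v::complex_vector \<Rightarrow> 'v) \<Rightarrow> bool"
  where "weight_module H \<rho> \<longleftrightarrow> is_direct_sum (dual_space H) (weight_space H \<rho>)"

definition real_root_vectors_locally_nilpotent ::
    "('g::complex_vector \<Rightarrow> 'g \<Rightarrow> 'g) \<Rightarrow> 'g set \<Rightarrow>
      (('g, 'n::finite, 'b::complex_comm_algebra_1) tau_loop \<Rightarrow> 'v::complex_vector \<Rightarrow> 'v) \<Rightarrow> 'b \<Rightarrow> bool"
  where "real_root_vectors_locally_nilpotent br \<hh> \<rho> b \<longleftrightarrow>
    (\<forall>\<alpha>\<in>roots br \<hh>. \<forall>x. root_vector br \<hh> \<alpha> x \<longrightarrow>
      (\<forall>m v. \<exists>k. (\<rho> (loop_elem x m b) ^^ k) v = 0))"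

text \<open>Integrability of a \<open>\<tau>(B)\<close>-module over \<open>\<tau>(B)\<close>, and over the subalgebra
  \<open>\<tau> = \<tau>\<^sub>0 \<otimes> 1 \<oplus> D\<close>, which has the same Cartan subalgebra.\<close>

definition integrable_tau_loop ::
    "('g::complex_vector \<Rightarrow> 'g \<Rightarrow> 'g) \<Rightarrow> 'g set \<Rightarrow>
      (('g, 'n::finite, 'b::complex_comm_algebra_1) tau_loop \<Rightarrow> 'v::complex_vector \<Rightarrow> 'v) \<Rightarrow> bool"
  where "integrable_tau_loop br \<hh> \<rho> \<longleftrightarrow> weight_module (toroidal_cartan \<hh>) \<rho> \<and>
    (\<forall>b. real_root_vectors_locally_nilpotent br \<hh> \<rho> b)"

definition integrable_tau ::
    "('g::complex_vector \<Rightarrow> 'g \<Rightarrow> 'g) \<Rightarrow> 'g set \<Rightarrow>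
      (('g, 'n::finite, 'b::complex_comm_algebra_1) tau_loop \<Rightarrow> 'v::complex_vector \<Rightarrow> 'v) \<Rightarrow> bool"
  where "integrable_tau br \<hh> \<rho> \<longleftrightarrow> weight_module (toroidal_cartan \<hh>) \<rho> \<and>
    real_root_vectors_locally_nilpotent br \<hh> \<rho> 1"

end

theory Submission
  imports Defs
begin

text \<open>Over \<open>\<tau>(B)\<close> integrability asks for more, so only one direction needs an argument. It rests
  on the finiteness of a weight string. Let \<open>x\<close> be a root vector of root \<open>\<alpha>\<close> and \<open>v\<close> a vector of
  weight \<open>\<mu>\<close>. For every \<open>b\<close> the element \<open>x \<otimes> t\<^sup>m \<otimes> b\<close> adds the same \<open>\<beta> = \<alpha> + \<delta>\<^sub>m\<close> to the weight,
  where \<open>\<delta>\<^sub>m\<close> is the degree \<open>m\<close> as a functional on the Cartan subalgebra. Its \<open>k\<close>-th power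
  therefore kills \<open>v\<close> as soon as the weight space \<open>M\<^sub>k\<close> of weight \<open>\<mu> + k \<beta>\<close> vanishes, and whether it
  does can be decided with \<open>b = 1\<close> alone.

  The element \<open>e = x \<otimes> t\<^sup>m \<otimes> 1\<close> belongs to an \<open>sl\<^sub>2\<close>-triple \<open>e, f, h\<close> with \<open>f = y \<otimes> t\<^bsup>-m\<^esup> \<otimes> 1\<close>, where
  \<open>y\<close> is a root vector of root \<open>-\<alpha>\<close>, and \<open>h = [e, f]\<close> lies in the Cartan subalgebra of \<open>\<tau>\<close>; on
  \<open>M\<^sub>k\<close> it has the eigenvalue \<open>\<mu>(h) + 2 k\<close>. Since \<open>e\<close> is locally nilpotent, it maps
  \<open>M\<^sub>k\<close> onto \<open>M\<^bsub>k+1\<^esub>\<close> once the latter eigenvalue has positive real part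
  (\<open>sl2_raising_surjective\<close>). So from some \<open>j\<close> on, \<open>M\<^bsub>j+i\<^esub> = e\<^sup>i M\<^sub>j\<close>; as \<open>M\<^sub>j\<close> is finite
  dimensional, one power of \<open>e\<close> kills all of it, and the string stops
  (\<open>sl2_weight_string_terminates\<close>).

  The partner \<open>y\<close> comes from the structure theory of the simple Lie algebra
  (\<open>exists_sl2_partner\<close>): the simultaneous eigenvectors of the Cartan subalgebra span, so the
  invariant form pairs \<open>x\<close> nontrivially with some vector of weight \<open>-\<alpha>\<close>; and \<open>\<alpha>([x, y]) \<noteq> 0\<close>,
  since otherwise \<open>x, y, [x, y]\<close> would span a Heisenberg algebra, whose centre cannot act on a finite
  dimensional space with a nonzero eigenvalue.\<close>

section \<open>Powers of linear operators\<close>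

lemma clinear_funpow:
  fixes T :: "'a::complex_vector \<Rightarrow> 'a"
  assumes "clinear T"
  shows "clinear (T ^^ n)"
  by (induction n) (auto intro!: clinearI simp: clinearD[OF assms] clinearD)

text \<open>The sum of the exponents of the finitely many generators serves for all of them at once.\<close>

lemma uniformly_nilpotent_on_finite_span:
  fixes T :: "'a::complex_vector \<Rightarrow> 'a"
  assumes T: "clinear T" and "finite F" and nil: "\<And>v. v \<in> F \<Longrightarrow> \<exists>n. (T ^^ n) v = 0"
  shows "\<exists>N. \<forall>v\<in>cspan F. (T ^^ N) v = 0"
proof -
  obtain n where n: "(T ^^ n v) v = 0" if "v \<in> F" for v
    using nil by metis
  have "(T ^^ (\<Sum>v\<in>F. n v)) v = 0" if "v \<in> F" for v
  proof -
    have "(\<Sum>v\<in>F. n v) = (\<Sum>v\<in>F - {v}. n v) + n v"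
      using \<open>finite F\<close> that by (simp add: sum.remove)
    then show ?thesis
      by (simp add: funpow_add n[OF that] clinearD[OF clinear_funpow[OF T]])
  qed
  then have "(T ^^ (\<Sum>v\<in>F. n v)) v = 0" if "v \<in> cspan F" for v
    using clinear_zero_on_span[OF clinear_funpow[OF T]] that by blast
  then show ?thesis
    by blast
qed

section \<open>Eigenvectors of commuting diagonalizable operators\<close>

lemma eigenvalue_shift_funpow:
  fixes T X :: "'a::complex_vector \<Rightarrow> 'a"
  assumes "clinear X" and shift: "\<And>v. T (X v) = X (T v) + a *\<^sub>C X v" and w: "T w = c *\<^sub>C w"
  shows "T ((X ^^ n) w) = (c + of_nat n * a) *\<^sub>C (X ^^ n) w"
proof (induction n)
  case 0
  show ?case by (simp add: w)
next
  case (Suc n)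
  have "T ((X ^^ Suc n) w) = ((c + of_nat n * a) + a) *\<^sub>C (X ^^ Suc n) w"
    by (simp only: funpow.simps comp_apply shift Suc.IH clinearD(1,4)[OF assms(1)] scaleC_add_left)
  also have "(c + of_nat n * a) + a = c + of_nat (Suc n) * a"
    by (simp add: algebra_simps)
  finally show ?case .
qed

text \<open>Applying \<open>T - ev j\<close> to the sum removes the \<open>j\<close>-th component and rescales the others by nonzero
  factors, which gives an induction on the number of components. For \<open>W = {0}\<close> this is the linear
  independence of eigenvectors with distinct eigenvalues.\<close>

lemma eigencomponents_in_invariant_subspace:
  assumes T: "clinear T" and W: "csubspace W" "\<And>w. w \<in> W \<Longrightarrow> T w \<in> W"
    and "finite I" "inj_on ev I" "\<And>i. i \<in> I \<Longrightarrow> T (g i) = ev i *\<^sub>C g i" "(\<Sum>i\<in>I. g i) \<in> W"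
  shows "\<forall>i\<in>I. g i \<in> W"
  using assms(4-)
proof (induction I arbitrary: g rule: finite_induct)
  case empty
  show ?case by simp
next
  case (insert j I)
  let ?s = "\<Sum>i\<in>insert j I. g i"
  have "T ?s - ev j *\<^sub>C ?s = (\<Sum>i\<in>insert j I. (ev i - ev j) *\<^sub>C g i)"
    using insert.prems(2)
    by (simp add: clinearD(6)[OF T] complex_vector.scale_sum_right complex_vector.scale_left_diff_distrib
        sum_subtractf[symmetric] del: sum.insert)
  also have "\<dots> = (\<Sum>i\<in>I. (ev i - ev j) *\<^sub>C g i)"
    using insert.hyps by simp
  finally have "(\<Sum>i\<in>I. (ev i - ev j) *\<^sub>C g i) \<in> W"
    by (metis W complex_vector.subspace_diff complex_vector.subspace_scale insert.prems(3))
  moreover have "inj_on ev I"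
    using insert.prems(1) by (auto simp: inj_on_def)
  moreover have "T ((ev i - ev j) *\<^sub>C g i) = ev i *\<^sub>C ((ev i - ev j) *\<^sub>C g i)" if "i \<in> I" for i
    using that insert.prems(2)[of i] by (simp add: clinearD(4)[OF T] scaleC_scaleC mult.commute)
  ultimately have scaled: "\<forall>i\<in>I. (ev i - ev j) *\<^sub>C g i \<in> W"
    by (intro insert.IH) auto
  have in_W: "g i \<in> W" if "i \<in> I" for i
  proof -
    have "ev i - ev j \<noteq> 0"
      using insert.prems(1) insert.hyps that by (auto simp: inj_on_def)
    moreover have "(1 / (ev i - ev j)) *\<^sub>C ((ev i - ev j) *\<^sub>C g i) \<in> W"
      using scaled that complex_vector.subspace_scale[OF W(1)] by blast
    ultimately show ?thesis
      by (simp add: scaleC_scaleC scaleC_one)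
  qed
  have "g j = ?s - (\<Sum>i\<in>I. g i)"
    using insert.hyps by simp
  then have "g j \<in> W"
    by (metis W(1) complex_vector.subspace_diff complex_vector.subspace_sum in_W insert.prems(3))
  with in_W show ?case by blast
qed

lemma span_eigenvectors_decomposition:
  assumes T: "clinear T" and "v \<in> cspan {x. \<exists>c. T x = c *\<^sub>C x}"
  shows "\<exists>C g. finite C \<and> (\<forall>c\<in>C. T (g c) = c *\<^sub>C g c) \<and> v = (\<Sum>c\<in>C. g c)"
  using assms(2)
proof (induction rule: complex_vector.span_induct_alt)
  case base
  have "finite {} \<and> (\<forall>c\<in>{}. T 0 = c *\<^sub>C 0) \<and> 0 = (\<Sum>c\<in>{}. 0)"
    by simp
  then show ?case by blast
next
  case (step a x y)
  then obtain c C g where c: "T x = c *\<^sub>C x" and C: "finite C" "\<forall>c\<in>C. T (g c) = c *\<^sub>C g c"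
    and y: "y = (\<Sum>c\<in>C. g c)"
    by blast
  define g1 where "g1 c' = (if c' \<in> C then g c' else 0)" for c'
  define g' where "g' c' = (if c' = c then a *\<^sub>C x else 0) + g1 c'" for c'
  have "T (g' c') = c' *\<^sub>C g' c'" if "c' \<in> insert c C" for c'
    using that C(2) c
    by (simp add: g'_def g1_def clinearD[OF T] scaleC_add_right scaleC_scaleC mult.commute)
  moreover have "(\<Sum>c'\<in>insert c C. g1 c') = y"
    unfolding y by (rule sum.mono_neutral_cong_right) (use C(1) in \<open>auto simp: g1_def\<close>)
  then have "a *\<^sub>C x + y = (\<Sum>c'\<in>insert c C. g' c')"
    using C(1) by (simp only: g'_def sum.distrib) (simp only: sum.delta finite_insert insertI1 if_True)
  ultimately show ?case
    using C(1) by (intro exI[of _ "insert c C"] exI[of _ g']) simp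
qed

lemma invariant_subspace_spanned_by_eigenvectors:
  assumes T: "clinear T" and diag: "cspan {x. \<exists>c. T x = c *\<^sub>C x} = UNIV"
    and W: "csubspace W" "\<And>w. w \<in> W \<Longrightarrow> T w \<in> W"
    and "w \<in> W"
  shows "w \<in> cspan {x \<in> W. \<exists>c. T x = c *\<^sub>C x}"
proof -
  obtain C g where C: "finite C" "\<forall>c\<in>C. T (g c) = c *\<^sub>C g c" "w = (\<Sum>c\<in>C. g c)"
    using span_eigenvectors_decomposition[OF T, of w] diag by auto
  then have "\<forall>c\<in>C. g c \<in> W"
    using eigencomponents_in_invariant_subspace[OF T W, of C "\<lambda>c. c" g] \<open>w \<in> W\<close> by auto
  then show ?thesis
    unfolding C(3) using C(2) by (intro complex_vector.span_sum complex_vector.span_base) auto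
qed

text \<open>Each joint eigenspace of some of the operators is invariant under the next one, because they
  commute, and so splits into eigenvectors of it.\<close>

lemma joint_eigenvectors_span:
  assumes "finite S" and T: "\<And>s. s \<in> S \<Longrightarrow> clinear (T s)"
    and diag: "\<And>s. s \<in> S \<Longrightarrow> cspan {x. \<exists>c. T s x = c *\<^sub>C x} = UNIV"
    and comm: "\<And>s s' x. s \<in> S \<Longrightarrow> s' \<in> S \<Longrightarrow> T s (T s' x) = T s' (T s x)"
  shows "cspan {x. \<forall>s\<in>S. \<exists>c. T s x = c *\<^sub>C x} = UNIV"
  using assms
proof (induction S rule: finite_induct)
  case empty
  show ?case by simp
next
  case (insert h S)
  let ?J = "{x. \<forall>s\<in>insert h S. \<exists>c. T s x = c *\<^sub>C x}"
  have "x \<in> cspan ?J" if x: "\<forall>s\<in>S. \<exists>c. T s x = c *\<^sub>C x" for x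
  proof -
    obtain \<gamma> where \<gamma>: "\<forall>s\<in>S. T s x = \<gamma> s *\<^sub>C x"
      using bchoice[OF x] by blast
    let ?W = "{y. \<forall>s\<in>S. T s y = \<gamma> s *\<^sub>C y}"
    have lin: "clinear (T s)" if "s \<in> insert h S" for s
      using insert.prems(1) that .
    have "csubspace ?W"
      by (rule complex_vector.subspaceI)
        (auto simp: clinearD[OF lin] scaleC_add_right scaleC_scaleC mult.commute)
    moreover have "T h y \<in> ?W" if "y \<in> ?W" for y
      using that insert.prems(3)[of _ h y] by (auto simp: clinearD[OF lin])
    ultimately have "x \<in> cspan {y \<in> ?W. \<exists>c. T h y = c *\<^sub>C y}"
      using \<gamma> insert.prems(2)[of h] lin[of h]
      by (intro invariant_subspace_spanned_by_eigenvectors) auto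
    moreover have "{y \<in> ?W. \<exists>c. T h y = c *\<^sub>C y} \<subseteq> ?J"
      by auto
    ultimately show ?thesis
      using complex_vector.span_mono by blast
  qed
  then have "cspan {x. \<forall>s\<in>S. \<exists>c. T s x = c *\<^sub>C x} \<subseteq> cspan ?J"
    by (intro complex_vector.span_minimal complex_vector.subspace_span) auto
  moreover have "cspan {x. \<forall>s\<in>S. \<exists>c. T s x = c *\<^sub>C x} = UNIV"
    by (rule insert.IH) (use insert.prems in auto)
  ultimately show ?case
    by auto
qed

text \<open>Otherwise the \<open>u n\<close> would be eigenvectors with pairwise distinct eigenvalues, hence an infinite
  linearly independent family.\<close>

lemma eigenvector_progression_vanishes:
  fixes T :: "'a::complex_vector \<Rightarrow> 'a"
  assumes fin: "finite_dim (UNIV :: 'a set)" and T: "clinear T"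
    and ev: "\<And>n. T (u n) = (c + of_nat n * a) *\<^sub>C u n" and "a \<noteq> 0"
  shows "\<exists>n. u n = 0"
proof (rule ccontr)
  assume "\<nexists>n. u n = 0"
  then have nz: "u n \<noteq> 0" for n
    by blast
  let ?ev = "\<lambda>n::nat. c + of_nat n * a"
  have inj_ev: "inj_on ?ev N" for N
    using \<open>a \<noteq> 0\<close> by (auto simp: inj_on_def)
  have inj: "inj u"
  proof (rule injI)
    fix m n assume "u m = u n"
    then have "?ev m *\<^sub>C u m = ?ev n *\<^sub>C u m"
      by (metis ev)
    then show "m = n"
      using nz[of m] \<open>a \<noteq> 0\<close> by (simp add: complex_vector.scale_right_imp_eq)
  qed
  have "complex_vector.independent (range u)"
    unfolding complex_vector.dependent_explicit
  proof (intro notI, elim exE conjE bexE)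
    fix S r v
    assume S: "finite S" "S \<subseteq> range u" "(\<Sum>v\<in>S. r v *\<^sub>C v) = 0" and v: "v \<in> S" "r v \<noteq> 0"
    obtain N where N: "S = u ` N"
      using S(2) by (auto simp: subset_image_iff)
    have inj_N: "inj_on u N"
      using inj by (rule inj_on_subset) simp
    have "(\<Sum>n\<in>N. r (u n) *\<^sub>C u n) = 0"
      using S(3) unfolding N by (simp add: sum.reindex[OF inj_N])
    moreover have "finite N"
      using S(1) N inj_N by (simp add: finite_image_iff)
    moreover have "T (r (u n) *\<^sub>C u n) = ?ev n *\<^sub>C (r (u n) *\<^sub>C u n)" for n
      by (simp add: clinearD(4)[OF T] ev scaleC_scaleC mult.commute)
    ultimately have "\<forall>n\<in>N. r (u n) *\<^sub>C u n \<in> {0}"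
      using inj_ev by (intro eigencomponents_in_invariant_subspace[OF T, where ev = ?ev])
        (simp_all add: clinearD(3)[OF T])
    then show False
      using v N nz by (auto simp: complex_vector.scale_eq_0_iff)
  qed
  moreover obtain F :: "'a set" where "finite F" "cspan F = UNIV"
    using fin by (auto simp: finite_dim_def)
  ultimately have "finite (range u)"
    using complex_vector.independent_span_bound[of F "range u"] by simp
  then show False
    using inj by (simp add: finite_image_iff)
qed

section \<open>Root vectors of a simple Lie algebra\<close>

lemma subspace_of_finite_dim:
  fixes S :: "'a::complex_vector set"
  assumes fin: "finite_dim (UNIV :: 'a set)" and "csubspace S"
  shows "finite_dim S"
proof -
  obtain F :: "'a set" where F: "finite F" "cspan F = UNIV"
    using fin by (auto simp: finite_dim_def)
  obtain B where B: "B \<subseteq> S" "complex_vector.independent B" "S \<subseteq> cspan B"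
    by (rule complex_vector.maximal_independent_subset)
  then have "finite B"
    using complex_vector.independent_span_bound[OF F(1) B(2)] F(2) by simp
  moreover have "cspan B = S"
    using B assms(2) complex_vector.span_minimal by blast
  ultimately show ?thesis
    by (auto simp: finite_dim_def)
qed

lemma simple_lie_algebra_centre_trivial:
  assumes "simple_lie_algebra br" "\<And>w. br z w = 0"
  shows "z = 0"
proof -
  have br: "lie_algebra br"
    using assms(1) by (simp add: simple_lie_algebra_def)
  note b = lie_algebraD[OF br]
  let ?I = "{z. \<forall>w. br z w = 0}"
  have "csubspace ?I"
    by (rule complex_vector.subspaceI) (simp_all add: cbilinearD[OF b(1)])
  moreover have "br x y \<in> ?I" if "y \<in> ?I" for x y
    using that b(3)[of x y] by (simp add: cbilinearD[OF b(1)])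
  moreover have "?I \<noteq> UNIV"
    using assms(1) by (auto simp: simple_lie_algebra_def)
  ultimately have "?I = {0}"
    using assms(1) unfolding simple_lie_algebra_def by blast
  then show ?thesis
    using assms(2) by blast
qed

text \<open>If \<open>Z = [X, Y]\<close> commutes with \<open>X\<close> and \<open>Y\<close>, then on the eigenspace of \<open>Z\<close> for \<open>d\<close> the operators \<open>X\<close>
  and \<open>Y\<close> satisfy the canonical commutation relation \<open>[X, Y] = d\<close>, which taking traces shows to be
  impossible in finite dimension unless \<open>d = 0\<close>. Here the grading by the eigenvalues of \<open>T\<close> replaces
  the trace: \<open>X\<close> and \<open>Y\<close> shift it by \<open>a\<close> and \<open>-a\<close>, so their powers eventually kill an eigenvector. Climb
  with \<open>X\<close> to a vector \<open>u\<close> with \<open>X u = 0\<close>; then \<open>X Y\<^bsup>n+1\<^esup> u = (n + 1) d Y\<^sup>n u\<close>, so the first vanishing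
  \<open>Y\<^bsup>n+1\<^esup> u\<close> forces \<open>d = 0\<close>.\<close>

lemma no_heisenberg_ladder:
  fixes X Y Z T :: "'a::complex_vector \<Rightarrow> 'a"
  assumes fin: "finite_dim (UNIV :: 'a set)"
    and lin: "clinear X" "clinear Y" "clinear T"
    and XY: "\<And>v. X (Y v) = Y (X v) + Z v"
    and ZX: "\<And>v. Z (X v) = X (Z v)" and ZY: "\<And>v. Z (Y v) = Y (Z v)"
    and TX: "\<And>v. T (X v) = X (T v) + a *\<^sub>C X v" and TY: "\<And>v. T (Y v) = Y (T v) - a *\<^sub>C Y v"
    and "a \<noteq> 0" and w: "T w = c *\<^sub>C w" "Z w = d *\<^sub>C w" "w \<noteq> 0"
  shows "d = 0"
proof (rule ccontr)
  assume "d \<noteq> 0"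
  have TXn: "T ((X ^^ n) w) = (c + of_nat n * a) *\<^sub>C (X ^^ n) w" for n
    by (rule eigenvalue_shift_funpow[OF lin(1) TX w(1)])
  have ZXn: "Z ((X ^^ n) w) = d *\<^sub>C (X ^^ n) w" for n
    using eigenvalue_shift_funpow[of X Z 0, OF lin(1) _ w(2)] by (simp add: ZX)
  have "\<exists>n. (X ^^ n) w = 0"
    by (rule eigenvector_progression_vanishes[OF fin lin(3) TXn \<open>a \<noteq> 0\<close>])
  then obtain N where N: "(X ^^ N) w = 0" "\<And>n. n < N \<Longrightarrow> (X ^^ n) w \<noteq> 0"
    using exists_least_iff[of "\<lambda>n. (X ^^ n) w = 0"] by blast
  then obtain p where p: "N = Suc p"
    using w(3) by (cases N) auto
  define u where "u = (X ^^ p) w"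
  have u: "X u = 0" "u \<noteq> 0"
    using N p by (auto simp: u_def)
  have TYn: "T ((Y ^^ n) u) = (c + of_nat p * a + of_nat n * (- a)) *\<^sub>C (Y ^^ n) u" for n
    by (rule eigenvalue_shift_funpow[OF lin(2)]) (simp_all add: TY u_def TXn)
  have ZYn: "Z ((Y ^^ n) u) = d *\<^sub>C (Y ^^ n) u" for n
    using eigenvalue_shift_funpow[of Y Z 0 u d n] by (simp add: lin ZY u_def ZXn)
  have XYn: "X ((Y ^^ Suc n) u) = (of_nat (Suc n) * d) *\<^sub>C (Y ^^ n) u" for n
  proof (induction n)
    case 0
    show ?case
      using ZYn[of 0] by (simp add: XY u clinearD[OF lin(2)])
  next
    case (Suc n)
    have "X ((Y ^^ Suc (Suc n)) u) = Y (X ((Y ^^ Suc n) u)) + Z ((Y ^^ Suc n) u)"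
      by (simp add: XY)
    also have "\<dots> = (of_nat (Suc n) * d + d) *\<^sub>C (Y ^^ Suc n) u"
      by (simp only: Suc.IH ZYn clinearD[OF lin(2)] scaleC_add_left) simp
    finally show ?case
      by (simp add: algebra_simps)
  qed
  have "\<exists>n. (Y ^^ n) u = 0"
    by (rule eigenvector_progression_vanishes[OF fin lin(3) TYn]) (use \<open>a \<noteq> 0\<close> in simp)
  then obtain M where M: "(Y ^^ M) u = 0" "\<And>n. n < M \<Longrightarrow> (Y ^^ n) u \<noteq> 0"
    using exists_least_iff[of "\<lambda>n. (Y ^^ n) u = 0"] by blast
  then obtain q where q: "M = Suc q"
    using u(2) by (cases M) auto
  have "(of_nat (Suc q) * d) *\<^sub>C (Y ^^ q) u = 0"
    using XYn[of q] M(1) by (simp add: q clinearD[OF lin(1)] del: of_nat_Suc)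
  then show False
    using M(2)[of q] q \<open>d \<noteq> 0\<close> by (simp add: complex_vector.scale_eq_0_iff del: of_nat_Suc)
qed

context
  fixes br :: "'g::complex_vector \<Rightarrow> 'g \<Rightarrow> 'g" and \<hh> :: "'g set" and \<kappa> :: "'g \<Rightarrow> 'g \<Rightarrow> complex"
  assumes simple: "simple_lie_algebra br" and fin: "finite_dim (UNIV :: 'g set)"
    and cartan: "cartan_subalgebra br \<hh>" and form: "invariant_form br \<kappa>"
begin

private lemma lie: "lie_algebra br"
  using simple by (simp add: simple_lie_algebra_def)

private lemma cartan_facts:
  shows "csubspace \<hh>" and "\<And>h h'. h \<in> \<hh> \<Longrightarrow> h' \<in> \<hh> \<Longrightarrow> br h h' = 0"
    and "\<And>x. (\<And>h. h \<in> \<hh> \<Longrightarrow> br h x = 0) \<Longrightarrow> x \<in> \<hh>"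
    and "\<And>h. h \<in> \<hh> \<Longrightarrow> cspan {x. \<exists>c. br h x = c *\<^sub>C x} = UNIV"
  using cartan unfolding cartan_subalgebra_def by blast+

private lemmas bil = lie_algebraD(1)[OF lie]

private lemma lin: "clinear (br x)"
  using bil by (simp add: cbilinear_def)

private lemma bracket_commutator: "br (br x y) w = br x (br y w) - br y (br x w)"
proof -
  have "br w x = - br x w" "br w (br x y) = - br (br x y) w"
    by (rule lie_algebraD(3)[OF lie])+
  then have "br x (br y w) - br y (br x w) - br (br x y) w = 0"
    using lie_algebraD(4)[OF lie, of x y w] by (simp add: cbilinearD[OF bil])
  then show ?thesis
    by simp
qed

private lemma cartan_joint_eigenvectors_span:
  assumes "finite S" "S \<subseteq> \<hh>"
  shows "cspan {x. \<forall>h\<in>S. \<exists>c. br h x = c *\<^sub>C x} = UNIV"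
proof (rule joint_eigenvectors_span[where T = br, OF assms(1) lin])
  fix h assume "h \<in> S"
  then show "cspan {x. \<exists>c. br h x = c *\<^sub>C x} = UNIV"
    using assms(2) by (intro cartan_facts(4)) (rule subsetD)
next
  fix h h' x assume "h \<in> S" "h' \<in> S"
  then have "br h h' = 0"
    by (intro cartan_facts(2) subsetD[OF assms(2)])
  then have "br h (br h' x) - br h' (br h x) = br 0 x"
    by (simp only: bracket_commutator[symmetric])
  also have "br 0 x = 0"
    by (rule cbilinearD(5)[OF bil])
  finally show "br h (br h' x) = br h' (br h x)"
    by (simp only: right_minus_eq)
qed

text \<open>The functional \<open>\<kappa> x\<close> is nonzero and therefore nonzero on some joint eigenvector \<open>y\<close>. Invariance gives
  \<open>\<kappa> x [h, y] = - \<alpha> h * \<kappa> x y\<close>, so the eigenvalue of \<open>h\<close> on \<open>y\<close> can only be \<open>- \<alpha> h\<close>. As only finitely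
  many operators are diagonalized simultaneously, this is done first for \<open>h\<close> in a finite set
  spanning \<open>\<hh>\<close>.\<close>

lemma exists_paired_opposite_root_vector:
  assumes \<alpha>: "\<alpha> \<in> dual_space \<hh>" and x: "root_vector br \<hh> \<alpha> x"
  shows "\<exists>y. \<kappa> x y \<noteq> 0 \<and> (\<forall>h\<in>\<hh>. br h y = (- \<alpha> h) *\<^sub>C y)"
proof -
  have \<kappa>: "cbilinear \<kappa>" and inv: "\<kappa> (br u v) w = \<kappa> u (br v w)"
    and nondeg: "(\<And>y. \<kappa> u y = 0) \<Longrightarrow> u = 0" for u v w
    using form unfolding invariant_form_def by blast+
  obtain S where S: "finite S" "cspan S = \<hh>"
    using subspace_of_finite_dim[OF fin cartan_facts(1)] by (auto simp: finite_dim_def)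
  have "S \<subseteq> \<hh>"
    using S(2) complex_vector.span_superset by blast
  have "clinear (\<kappa> x)"
    using \<kappa> by (simp add: cbilinear_def)
  have "\<exists>y. (\<forall>h\<in>S. \<exists>c. br h y = c *\<^sub>C y) \<and> \<kappa> x y \<noteq> 0"
  proof (rule ccontr)
    assume "\<not> ?thesis"
    then have "\<kappa> x y = 0" if "y \<in> cspan {x. \<forall>h\<in>S. \<exists>c. br h x = c *\<^sub>C x}" for y
      using clinear_zero_on_span[OF \<open>clinear (\<kappa> x)\<close> _ that] by blast
    then have "x = 0"
      using nondeg[of x] cartan_joint_eigenvectors_span[OF S(1) \<open>S \<subseteq> \<hh>\<close>] by simp
    then show False
      using x by (simp add: root_vector_def)
  qed
  then obtain y where y: "\<forall>h\<in>S. \<exists>c. br h y = c *\<^sub>C y" and "\<kappa> x y \<noteq> 0"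
    by blast
  have on_S: "br h y = (- \<alpha> h) *\<^sub>C y" if "h \<in> S" for h
  proof -
    obtain c where c: "br h y = c *\<^sub>C y"
      using y \<open>h \<in> S\<close> by blast
    have "br h x = \<alpha> h *\<^sub>C x"
      using x \<open>h \<in> S\<close> \<open>S \<subseteq> \<hh>\<close> by (auto simp: root_vector_def root_space_def)
    then have "br x h = (- \<alpha> h) *\<^sub>C x"
      using lie_algebraD(3)[OF lie, of x h] by simp
    then have "c * \<kappa> x y = - \<alpha> h * \<kappa> x y"
      using inv[of x h y] by (simp add: c cbilinearD[OF \<kappa>] scaleC_complex_def)
    then have "c = - \<alpha> h"
      using \<open>\<kappa> x y \<noteq> 0\<close> by (metis mult_right_cancel)
    then show ?thesis
      using c by simp
  qed
  have "h \<in> \<hh> \<and> br h y = (- \<alpha> h) *\<^sub>C y" if "h \<in> cspan S" for h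
    using that
  proof (induction rule: complex_vector.span_induct_alt)
    case base
    have "0 \<in> \<hh>"
      using S(2) complex_vector.span_zero by blast
    moreover have "\<alpha> (0 *\<^sub>C 0) = 0 * \<alpha> 0"
      using \<alpha> \<open>0 \<in> \<hh>\<close> unfolding dual_space_def by blast
    ultimately show ?case
      by (simp add: cbilinearD[OF bil])
  next
    case (step c h h')
    have h: "h \<in> \<hh>" "c *\<^sub>C h \<in> \<hh>"
      using step \<open>S \<subseteq> \<hh>\<close> cartan_facts(1) by (auto intro: complex_vector.subspace_scale)
    then have "\<alpha> (c *\<^sub>C h + h') = c * \<alpha> h + \<alpha> h'"
      using \<alpha> step unfolding dual_space_def by auto
    then show ?case
      using step h cartan_facts(1) on_S[of h]
      by (simp add: cbilinearD[OF bil] complex_vector.subspace_add scaleC_scaleC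
          complex_vector.scale_left_diff_distrib)
  qed
  then show ?thesis
    using \<open>\<kappa> x y \<noteq> 0\<close> S(2) by blast
qed

text \<open>The bracket \<open>[x, y]\<close> is a nonzero multiple of the element of \<open>\<hh>\<close> that represents \<open>\<alpha>\<close>, so the claim
  says that roots are not isotropic. If \<open>\<alpha>([x, y])\<close> were \<open>0\<close>, then \<open>[x, y]\<close> would commute with \<open>x\<close> and \<open>y\<close>
  and \<open>no_heisenberg_ladder\<close> would make all its eigenvalues \<open>0\<close>. Being diagonalizable, it would be
  central, hence \<open>0\<close>, whereas \<open>\<kappa> [x, y] h = \<alpha> h * \<kappa> x y\<close> is nonzero for some \<open>h\<close>.\<close>

lemma root_nonzero_on_coroot_direction:
  assumes \<alpha>: "\<exists>h\<in>\<hh>. \<alpha> h \<noteq> 0" and x: "x \<in> root_space br \<hh> \<alpha>"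
    and y: "\<forall>h\<in>\<hh>. br h y = (- \<alpha> h) *\<^sub>C y" and "\<kappa> x y \<noteq> 0"
  shows "br x y \<in> \<hh>" "\<alpha> (br x y) \<noteq> 0"
proof -
  have \<kappa>: "cbilinear \<kappa>" and inv: "\<kappa> (br u v) w = \<kappa> u (br v w)" for u v w
    using form unfolding invariant_form_def by blast+
  have hx: "br h x = \<alpha> h *\<^sub>C x" and hy: "br h y = (- \<alpha> h) *\<^sub>C y" if "h \<in> \<hh>" for h
    using x y that by (auto simp: root_space_def)
  have "br h (br x y) = 0" if "h \<in> \<hh>" for h
  proof -
    have "br h (br x y) = br (br h x) y + br x (br h y)"
      using bracket_commutator[of h x y] by (simp add: algebra_simps)
    then show ?thesis
      by (simp add: hx[OF that] hy[OF that] cbilinearD[OF bil])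
  qed
  then show z: "br x y \<in> \<hh>"
    by (rule cartan_facts(3))
  show "\<alpha> (br x y) \<noteq> 0"
  proof
    assume zero: "\<alpha> (br x y) = 0"
    obtain h where h: "h \<in> \<hh>" "\<alpha> h \<noteq> 0"
      using \<alpha> by blast
    have joint: "cspan {w. \<forall>h'\<in>{br x y, h}. \<exists>c. br h' w = c *\<^sub>C w} = UNIV"
      using z h by (intro cartan_joint_eigenvectors_span) auto
    have "br (br x y) w = 0" if w: "\<forall>h'\<in>{br x y, h}. \<exists>c. br h' w = c *\<^sub>C w" for w
    proof (cases "w = 0")
      case True
      then show ?thesis by (simp add: cbilinearD[OF bil])
    next
      case False
      obtain c d where c: "br h w = c *\<^sub>C w" and d: "br (br x y) w = d *\<^sub>C w"
        using w by auto
      have comm: "br u (br v w) = br v (br u w) + br (br u v) w" for u v w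
        by (simp add: bracket_commutator)
      have "br x (br y v) = br y (br x v) + br (br x y) v"
        "br (br x y) (br x v) = br x (br (br x y) v)" "br (br x y) (br y v) = br y (br (br x y) v)"
        "br h (br x v) = br x (br h v) + \<alpha> h *\<^sub>C br x v"
        "br h (br y v) = br y (br h v) - \<alpha> h *\<^sub>C br y v" for v
        using comm[of x y v] comm[of "br x y" x v] comm[of "br x y" y v] comm[of h x v] comm[of h y v]
        unfolding hx[OF h(1)] hy[OF h(1)] hx[OF z] hy[OF z] zero
        by (simp_all add: cbilinearD[OF bil])
      then have "d = 0"
        by (rule no_heisenberg_ladder[OF fin lin[of x] lin[of y] lin[of h]])
          (fact h c d False)+
      then show ?thesis
        by (simp add: d)
    qed
    then have "br (br x y) w = 0" for w
      by (rule clinear_zero_on_span[OF lin, where S = "{w. \<forall>h'\<in>{br x y, h}. \<exists>c. br h' w = c *\<^sub>C w}"])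
        (simp_all only: mem_Collect_eq joint UNIV_I)
    then have "br x y = 0"
      by (rule simple_lie_algebra_centre_trivial[OF simple])
    moreover have "\<kappa> (br x y) h = \<alpha> h * \<kappa> x y"
      using inv[of x y h] lie_algebraD(3)[OF lie, of y h]
      by (simp add: hy[OF h(1)] cbilinearD[OF \<kappa>] scaleC_complex_def)
    ultimately show False
      using h \<open>\<kappa> x y \<noteq> 0\<close> by (simp add: cbilinearD[OF \<kappa>])
  qed
qed

lemma exists_sl2_partner:
  assumes \<alpha>: "\<alpha> \<in> roots br \<hh>" and x: "root_vector br \<hh> \<alpha> x"
  shows "\<exists>y. (\<forall>h\<in>\<hh>. br h y = (- \<alpha> h) *\<^sub>C y) \<and> br x y \<in> \<hh> \<and> \<alpha> (br x y) = 2"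
proof -
  have dual: "\<alpha> \<in> dual_space \<hh>" and nz: "\<exists>h\<in>\<hh>. \<alpha> h \<noteq> 0"
    using \<alpha> by (auto simp: roots_def)
  obtain y where y: "\<kappa> x y \<noteq> 0" "\<forall>h\<in>\<hh>. br h y = (- \<alpha> h) *\<^sub>C y"
    using exists_paired_opposite_root_vector[OF dual x] by blast
  have z: "br x y \<in> \<hh>" "\<alpha> (br x y) \<noteq> 0"
    using root_nonzero_on_coroot_direction[OF nz _ y(2,1)] x by (auto simp: root_vector_def)
  define c where "c = 2 / \<alpha> (br x y)"
  have "br x (c *\<^sub>C y) = c *\<^sub>C br x y"
    by (simp only: cbilinearD(4)[OF bil])
  moreover have "c *\<^sub>C br x y \<in> \<hh>"
    using cartan_facts(1) z(1) by (rule complex_vector.subspace_scale)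
  moreover have "\<alpha> (c *\<^sub>C br x y) = 2"
    using dual z unfolding dual_space_def by (simp add: c_def)
  moreover have "\<forall>h\<in>\<hh>. br h (c *\<^sub>C y) = (- \<alpha> h) *\<^sub>C (c *\<^sub>C y)"
    using y(2) by (simp add: cbilinearD(4)[OF bil] scaleC_scaleC mult.commute)
  ultimately show ?thesis
    by metis
qed

end

section \<open>Weight strings of locally nilpotent \<open>sl\<^sub>2\<close>-actions\<close>

context
  fixes e f h :: "'v::complex_vector \<Rightarrow> 'v"
  assumes e: "clinear e" and f: "clinear f"
    and ef: "\<And>v. e (f v) = f (e v) + h v" and he: "\<And>v. h (e v) = e (h v) + 2 *\<^sub>C e v"
begin

lemma sl2_weight_raising:
  assumes "h v = \<nu> *\<^sub>C v"
  shows "h ((e ^^ n) v) = (\<nu> + 2 * of_nat n) *\<^sub>C (e ^^ n) v"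
  using eigenvalue_shift_funpow[of e h 2 v \<nu> n] by (simp add: e he assms mult.commute)

lemma sl2_power_commutator:
  assumes "h v = \<nu> *\<^sub>C v"
  shows "(e ^^ Suc n) (f v) = f ((e ^^ Suc n) v) + (of_nat (Suc n) * (\<nu> + of_nat n)) *\<^sub>C (e ^^ n) v"
proof (induction n)
  case 0
  show ?case
    by (simp add: ef assms)
next
  case (Suc n)
  have "(e ^^ Suc (Suc n)) (f v) = e ((e ^^ Suc n) (f v))"
    by simp
  also have "\<dots> = e (f ((e ^^ Suc n) v)) + (of_nat (Suc n) * (\<nu> + of_nat n)) *\<^sub>C (e ^^ Suc n) v"
    by (simp only: Suc.IH clinearD[OF e]) simp
  also have "\<dots> = f ((e ^^ Suc (Suc n)) v) + ((\<nu> + 2 * of_nat (Suc n)) *\<^sub>C (e ^^ Suc n) v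
      + (of_nat (Suc n) * (\<nu> + of_nat n)) *\<^sub>C (e ^^ Suc n) v)"
    by (simp only: ef sl2_weight_raising[OF assms]) simp
  also have "\<dots> = f ((e ^^ Suc (Suc n)) v)
      + (of_nat (Suc (Suc n)) * (\<nu> + of_nat (Suc n))) *\<^sub>C (e ^^ Suc n) v"
    by (simp only: scaleC_add_left[symmetric]) (simp add: algebra_simps)
  finally show ?case .
qed

text \<open>Modulo \<open>ker e\<^sup>n\<close>, the operator \<open>e f\<close> acts on \<open>Q \<inter> ker e\<^bsup>n+1\<^esup>\<close> as the scalar \<open>c = (n + 1) (\<nu> + n)\<close>, by
  the commutator formula. This scalar is nonzero for \<open>Re \<nu> > 0\<close>, and \<open>c v\<close> differs from \<open>e (f v)\<close> by a
  vector of \<open>Q\<close> that is already killed by \<open>e\<^sup>n\<close>.\<close>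

lemma sl2_raising_surjective:
  assumes P: "csubspace P" and Q: "csubspace Q"
    and eP: "\<And>v. v \<in> P \<Longrightarrow> e v \<in> Q" and fQ: "\<And>v. v \<in> Q \<Longrightarrow> f v \<in> P"
    and hQ: "\<And>v. v \<in> Q \<Longrightarrow> h v = \<nu> *\<^sub>C v" and pos: "Re \<nu> > 0"
  shows "v \<in> Q \<Longrightarrow> (e ^^ n) v = 0 \<Longrightarrow> v \<in> e ` P"
proof (induction n arbitrary: v)
  case 0
  then have "v = e 0"
    by (simp add: clinearD[OF e])
  then show ?case
    using complex_vector.subspace_0[OF P] by blast
next
  case (Suc n)
  let ?c = "of_nat (Suc n) * (\<nu> + of_nat n) :: complex"
  let ?w = "e (f v) - ?c *\<^sub>C v"
  have "Re (\<nu> + of_nat n) > 0"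
    using pos by simp
  then have c: "?c \<noteq> 0"
    by (metis less_irrefl mult_eq_0_iff of_nat_eq_0_iff old.nat.distinct(2) zero_complex.simps(1))
  have "(e ^^ n) (e (f v)) = ?c *\<^sub>C (e ^^ n) v"
    using sl2_power_commutator[OF hQ[OF Suc.prems(1)], of n] Suc.prems(2)
    by (simp only: funpow_Suc_right comp_apply clinearD[OF f]) simp
  then have "(e ^^ n) ?w = 0"
    by (simp only: clinearD[OF clinear_funpow[OF e]]) simp
  moreover have "?w \<in> Q"
    using Suc.prems(1) Q eP fQ
    by (intro complex_vector.subspace_diff[OF Q] complex_vector.subspace_scale[OF Q]) auto
  ultimately obtain p where p: "p \<in> P" "?w = e p"
    using Suc.IH by blast
  have "v = e ((1 / ?c) *\<^sub>C (f v - p))"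
    using c p(2)[symmetric]
    by (simp only: clinearD[OF e]) (simp add: scaleC_scaleC scaleC_one del: of_nat_Suc)
  moreover have "(1 / ?c) *\<^sub>C (f v - p) \<in> P"
    using Suc.prems(1) p(1) fQ
    by (intro complex_vector.subspace_scale[OF P] complex_vector.subspace_diff[OF P]) auto
  ultimately show ?case
    by blast
qed

text \<open>If \<open>h\<close> has an eigenvalue with positive real part on \<open>M\<^bsub>j+1\<^esub>\<close>, hence on all later spaces, then
  \<open>M\<^bsub>j+i\<^esub> = e\<^sup>i M\<^sub>j\<close> for all \<open>i\<close>, and a single power of \<open>e\<close> kills the finite dimensional \<open>M\<^sub>j\<close>.\<close>

lemma sl2_weight_string_terminates:
  fixes M :: "nat \<Rightarrow> 'v set"
  assumes sub: "\<And>k. csubspace (M k)" and fd: "\<And>k. finite_dim (M k)"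
    and eM: "\<And>k v. v \<in> M k \<Longrightarrow> e v \<in> M (Suc k)" and fM: "\<And>k v. v \<in> M (Suc k) \<Longrightarrow> f v \<in> M k"
    and hM: "\<And>k v. v \<in> M k \<Longrightarrow> h v = (\<nu> + 2 * of_nat k) *\<^sub>C v"
    and nil: "\<And>v. \<exists>n. (e ^^ n) v = 0"
  shows "\<exists>k. M k = {0}"
proof -
  obtain j :: nat where j: "- Re \<nu> < real j"
    using reals_Archimedean2 by blast
  obtain F where F: "finite F" "cspan F = M j"
    using fd[of j] by (auto simp: finite_dim_def)
  obtain N where N: "\<forall>v\<in>M j. (e ^^ N) v = 0"
    using uniformly_nilpotent_on_finite_span[OF e F(1) nil] F(2) by blast
  have "v \<in> (e ^^ i) ` M j" if "v \<in> M (i + j)" for i v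
    using that
  proof (induction i arbitrary: v)
    case 0
    then show ?case by simp
  next
    case (Suc i)
    obtain n where "(e ^^ n) v = 0"
      using nil by blast
    then have "v \<in> e ` M (i + j)"
      using Suc.prems j
      by (intro sl2_raising_surjective[of "M (i + j)" "M (Suc (i + j))" "\<nu> + 2 * of_nat (Suc (i + j))" v n])
        (auto simp: sub eM fM hM[of _ "Suc (i + j)"] simp del: of_nat_Suc, simp)
    then show ?case
      using Suc.IH by force
  qed
  then have "M (N + j) \<subseteq> {0}"
    using N by blast
  then show ?thesis
    using complex_vector.subspace_0[OF sub] by blast
qed

end


section \<open>Weight spaces under the toroidal Cartan subalgebra\<close>

lemma loop_elem_scale: "loop_elem (c *\<^sub>C x) m b = c *\<^sub>C loop_elem x m b"
  by (simp add: loop_elem_def scaleC_prod_def cbilinearD[OF cbilinear_pure_tensor, symmetric])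

lemma weight_space_subspace:
  assumes "cbilinear \<rho>"
  shows "csubspace (weight_space H \<rho> \<mu>)"
  unfolding weight_space_def
  by (rule complex_vector.subspaceI)
    (auto simp: cbilinearD[OF assms] scaleC_add_right scaleC_scaleC mult.commute)

lemma weight_space_shift:
  assumes \<rho>: "lie_module br \<rho>" and E: "\<And>h. h \<in> H \<Longrightarrow> br h E = \<beta> h *\<^sub>C E"
    and v: "v \<in> weight_space H \<rho> \<mu>"
  shows "\<rho> E v \<in> weight_space H \<rho> (\<lambda>h. \<mu> h + \<beta> h)"
proof -
  have bil: "cbilinear \<rho>" and act: "\<rho> (br x y) w = \<rho> x (\<rho> y w) - \<rho> y (\<rho> x w)" for x y w
    using \<rho> by (auto simp: lie_module_def)
  have "\<rho> h (\<rho> E v) = (\<mu> h + \<beta> h) *\<^sub>C \<rho> E v" if "h \<in> H" for h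
  proof -
    have "\<rho> h v = \<mu> h *\<^sub>C v"
      using v that by (simp add: weight_space_def)
    moreover have "\<rho> h (\<rho> E v) = \<rho> E (\<rho> h v) + \<rho> (br h E) v"
      by (simp add: act)
    ultimately show ?thesis
      by (simp add: E[OF that] cbilinearD[OF bil] scaleC_add_left)
  qed
  then show ?thesis
    by (simp add: weight_space_def)
qed

text \<open>This spares the construction of the weights \<open>\<mu> + k \<beta>\<close> as elements of the dual space: a weight space
  of an arbitrary function \<open>\<mu>\<close> is zero unless \<open>\<mu>\<close> is linear on \<open>H\<close>.\<close>

lemma weight_is_linear_functional:
  assumes \<rho>: "cbilinear \<rho>" and H: "csubspace H" and v: "v \<in> weight_space H \<rho> \<mu>" "v \<noteq> 0"
  shows "restrict \<mu> H \<in> dual_space H"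
proof -
  have act: "\<rho> h v = \<mu> h *\<^sub>C v" if "h \<in> H" for h
    using v(1) that by (simp add: weight_space_def)
  have "\<mu> (x + y) = \<mu> x + \<mu> y" if "x \<in> H" "y \<in> H" for x y
  proof -
    have "\<mu> (x + y) *\<^sub>C v = \<rho> (x + y) v"
      by (rule act[symmetric]) (rule complex_vector.subspace_add[OF H that])
    also have "\<dots> = (\<mu> x + \<mu> y) *\<^sub>C v"
      by (simp add: cbilinearD[OF \<rho>] act that scaleC_add_left)
    finally show ?thesis
      using v(2) complex_vector.scale_right_imp_eq by blast
  qed
  moreover have "\<mu> (c *\<^sub>C x) = c * \<mu> x" if "x \<in> H" for c x
  proof -
    have "\<mu> (c *\<^sub>C x) *\<^sub>C v = \<rho> (c *\<^sub>C x) v"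
      by (rule act[symmetric]) (rule complex_vector.subspace_scale[OF H that])
    also have "\<dots> = (c * \<mu> x) *\<^sub>C v"
      by (simp add: cbilinearD[OF \<rho>] act that scaleC_scaleC)
    finally show ?thesis
      using v(2) complex_vector.scale_right_imp_eq by blast
  qed
  ultimately show ?thesis
    by (simp add: dual_space_def complex_vector.subspace_add[OF H] complex_vector.subspace_scale[OF H])
qed

lemma finite_dim_weight_space:
  assumes \<rho>: "cbilinear \<rho>" and H: "csubspace H"
    and fd: "\<forall>\<mu>\<in>dual_space H. finite_dim (weight_space H \<rho> \<mu>)"
  shows "finite_dim (weight_space H \<rho> \<mu>)"
proof (cases "weight_space H \<rho> \<mu> = {0}")
  case True
  then show ?thesis
    unfolding finite_dim_def by (intro exI[of _ "{}"]) simp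
next
  case False
  then obtain v where "v \<in> weight_space H \<rho> \<mu>" "v \<noteq> 0"
    using complex_vector.subspace_0[OF weight_space_subspace[OF \<rho>]] by blast
  then have "restrict \<mu> H \<in> dual_space H"
    by (rule weight_is_linear_functional[OF \<rho> H])
  moreover have "weight_space H \<rho> (restrict \<mu> H) = weight_space H \<rho> \<mu>"
    by (simp add: weight_space_def)
  ultimately show ?thesis
    using fd by metis
qed

text \<open>The eigenvalue \<open>c\<close> must be the same for all \<open>b\<close>: this is why \<open>x \<otimes> t\<^sup>m \<otimes> b\<close> moves along the weight
  string of \<open>x \<otimes> t\<^sup>m \<otimes> 1\<close>.\<close>

lemma toroidal_cartan_acts_on_opposite_pair:
  fixes br :: "'g::complex_vector \<Rightarrow> 'g \<Rightarrow> 'g" and m :: "'n::finite exponent"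
    and U :: "('g, 'n, 'b::complex_comm_algebra_1) tau_loop"
  assumes br: "cbilinear br" and \<kappa>: "cbilinear \<kappa>"
    and x: "\<And>h. h \<in> \<hh> \<Longrightarrow> br h x = \<alpha> h *\<^sub>C x" and y: "\<And>h. h \<in> \<hh> \<Longrightarrow> br h y = (- \<alpha> h) *\<^sub>C y"
    and "U \<in> toroidal_cartan \<hh>"
  shows "\<exists>c. (\<forall>b. tau_loop_bracket br \<kappa> U (loop_elem x m b) = c *\<^sub>C loop_elem x m b) \<and>
    (\<forall>b. tau_loop_bracket br \<kappa> U (loop_elem y (- m) b) = (- c) *\<^sub>C loop_elem y (- m) b)"
  using assms(5) unfolding toroidal_cartan_def
proof (induction rule: complex_vector.span_induct_alt)
  case base
  have "tau_loop_bracket br \<kappa> 0 V = 0" for V :: "('g, 'n, 'b) tau_loop"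
    by (rule cbilinearD(5)[OF cbilinear_tau_loop_bracket[OF br \<kappa>]])
  then show ?case
    by (intro exI[of _ 0]) simp
next
  case (step a U U')
  let ?T = "tau_loop_bracket br \<kappa> :: ('g, 'n, 'b) tau_loop \<Rightarrow> _"
  note T = cbilinearD[OF cbilinear_tau_loop_bracket[OF br \<kappa>, where 'n = 'n and 'b = 'b]]
  note simps = tau_loop_bracket_simps[OF br \<kappa>]
  have "\<exists>c. (\<forall>b. ?T U (loop_elem x m b) = c *\<^sub>C loop_elem x m b) \<and>
      (\<forall>b. ?T U (loop_elem y (- m) b) = (- c) *\<^sub>C loop_elem y (- m) b)"
    using step(1)
  proof (elim UnE imageE)
    fix h assume "U = loop_elem h 0 1" "h \<in> \<hh>"
    then show ?thesis
      by (intro exI[of _ "\<alpha> h"]) (simp add: simps x y loop_elem_scale[symmetric])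
  next
    fix i assume "U = central_elem 0 i 1"
    then show ?thesis
      by (intro exI[of _ 0]) (simp add: simps)
  next
    fix i assume "U = der_elem i"
    then show ?thesis
      by (intro exI[of _ "of_int (m $ i)"]) (simp add: simps)
  qed
  then obtain c c' where
    "\<forall>b. ?T U (loop_elem x m b) = c *\<^sub>C loop_elem x m b"
    "\<forall>b. ?T U (loop_elem y (- m) b) = (- c) *\<^sub>C loop_elem y (- m) b"
    "\<forall>b. ?T U' (loop_elem x m b) = c' *\<^sub>C loop_elem x m b"
    "\<forall>b. ?T U' (loop_elem y (- m) b) = (- c') *\<^sub>C loop_elem y (- m) b"
    using step(2) by blast
  then show ?case
    by (intro exI[of _ "a * c + c'"])
      (simp add: T scaleC_add_left scaleC_scaleC complex_vector.scale_left_diff_distrib)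
qed

lemma root_vector_bracket_in_toroidal_cartan:
  fixes br :: "'g::complex_vector \<Rightarrow> 'g \<Rightarrow> 'g" and m :: "'n::finite exponent"
  assumes br: "cbilinear br" and \<kappa>: "cbilinear \<kappa>" and "br x y \<in> \<hh>"
  shows "tau_loop_bracket br \<kappa> (loop_elem x m 1) (loop_elem y (- m) 1) \<in>
    (toroidal_cartan \<hh> :: ('g, 'n, 'b::complex_comm_algebra_1) tau_loop set)"
proof -
  let ?G = "(\<lambda>h. loop_elem h 0 1) ` \<hh> \<union> range (\<lambda>i. central_elem 0 i 1) \<union> range der_elem
    :: ('g, 'n, 'b) tau_loop set"
  have "loop_elem (br x y) 0 1 + \<kappa> x y *\<^sub>C (\<Sum>i\<in>UNIV. of_int (m $ i) *\<^sub>C central_elem 0 i 1) \<in> cspan ?G"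
    using assms(3)
    by (intro complex_vector.span_add complex_vector.span_scale complex_vector.span_sum
        complex_vector.span_base) auto
  then show ?thesis
    by (simp add: tau_loop_bracket_simps[OF br \<kappa>] toroidal_cartan_def)
qed

text \<open>The central part of \<open>[x \<otimes> t\<^sup>m, y \<otimes> t\<^bsup>-m\<^esup>]\<close> does not act, and its loop part \<open>[x, y]\<close> has degree \<open>0\<close>, so
  that no central term arises from it either.\<close>

lemma coroot_direction_acts_on_root_elem:
  fixes br :: "'g::complex_vector \<Rightarrow> 'g \<Rightarrow> 'g" and m :: "'n::finite exponent"
    and b :: "'b::complex_comm_algebra_1"
  assumes br: "cbilinear br" and \<kappa>: "cbilinear \<kappa>" and z: "br (br x y) w = c *\<^sub>C w"
  shows "tau_loop_bracket br \<kappa> (tau_loop_bracket br \<kappa> (loop_elem x m 1) (loop_elem y (- m) 1))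
    (loop_elem w r b) = c *\<^sub>C loop_elem w r b"
proof -
  let ?T = "tau_loop_bracket br \<kappa> :: ('g, 'n, 'b) tau_loop \<Rightarrow> _"
  note bil = cbilinear_tau_loop_bracket[OF br \<kappa>, where 'n = 'n and 'b = 'b]
  note T = cbilinearD[OF bil]
  have lin: "clinear (\<lambda>U. ?T U (loop_elem w r b))"
    using bil unfolding cbilinear_def by blast
  show ?thesis
    by (simp add: tau_loop_bracket_simps[OF br \<kappa>] T clinearD(6)[OF lin] z loop_elem_scale)
qed

lemma root_vector_nilpotent_on_weight_vector:
  fixes br :: "'g::complex_vector \<Rightarrow> 'g \<Rightarrow> 'g"
    and \<rho> :: "('g, 'n::finite, 'b::complex_comm_algebra_1) tau_loop \<Rightarrow> 'v::complex_vector \<Rightarrow> 'v"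
  assumes simple: "simple_lie_algebra br" and fin: "finite_dim (UNIV :: 'g set)"
    and cartan: "cartan_subalgebra br \<hh>" and form: "invariant_form br \<kappa>"
    and module: "lie_module (tau_loop_bracket br \<kappa>) \<rho>"
    and fd: "\<forall>\<mu>\<in>dual_space (toroidal_cartan \<hh>). finite_dim (weight_space (toroidal_cartan \<hh>) \<rho> \<mu>)"
    and nil: "real_root_vectors_locally_nilpotent br \<hh> \<rho> 1"
    and \<alpha>: "\<alpha> \<in> roots br \<hh>" and x: "root_vector br \<hh> \<alpha> x"
    and v: "v \<in> weight_space (toroidal_cartan \<hh>) \<rho> \<mu>"
  shows "\<exists>k. (\<rho> (loop_elem x m b) ^^ k) v = 0"
proof -
  let ?H = "toroidal_cartan \<hh> :: ('g, 'n, 'b) tau_loop set"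
  let ?T = "tau_loop_bracket br \<kappa> :: ('g, 'n, 'b) tau_loop \<Rightarrow> _"
  have br: "cbilinear br" and \<kappa>: "cbilinear \<kappa>"
    using simple form by (auto simp: simple_lie_algebra_def lie_algebra_def invariant_form_def)
  have \<rho>: "cbilinear \<rho>" and act: "\<rho> (?T X Y) u = \<rho> X (\<rho> Y u) - \<rho> Y (\<rho> X u)" for X Y u
    using module unfolding lie_module_def by blast+
  have lin: "clinear (\<rho> X)" for X
    using \<rho> unfolding cbilinear_def by blast
  have H: "csubspace ?H"
    unfolding toroidal_cartan_def by (rule complex_vector.subspace_span)
  obtain y where y: "\<And>h. h \<in> \<hh> \<Longrightarrow> br h y = (- \<alpha> h) *\<^sub>C y"
    and z: "br x y \<in> \<hh>" "\<alpha> (br x y) = 2"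
    using exists_sl2_partner[OF simple fin cartan form \<alpha> x] by blast
  have x': "br h x = \<alpha> h *\<^sub>C x" if "h \<in> \<hh>" for h
    using x that by (simp add: root_vector_def root_space_def)
  let ?e = "loop_elem x m 1 :: ('g, 'n, 'b) tau_loop"
  let ?f = "loop_elem y (- m) 1 :: ('g, 'n, 'b) tau_loop"
  let ?h = "?T ?e ?f"
  have hH: "?h \<in> ?H"
    by (rule root_vector_bracket_in_toroidal_cartan[OF br \<kappa> z(1)])
  let ?P = "\<lambda>U c. (\<forall>b. ?T U (loop_elem x m b) = c *\<^sub>C loop_elem x m b) \<and>
    (\<forall>b. ?T U (loop_elem y (- m) b) = (- c) *\<^sub>C loop_elem y (- m) b)"
  have P_h: "?P ?h 2"
  proof (intro conjI allI)
    show "?T ?h (loop_elem x m b) = 2 *\<^sub>C loop_elem x m b" for b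
      by (rule coroot_direction_acts_on_root_elem[OF br \<kappa>]) (simp only: x'[OF z(1)] z(2))
    show "?T ?h (loop_elem y (- m) b) = (- 2) *\<^sub>C loop_elem y (- m) b" for b
      by (rule coroot_direction_acts_on_root_elem[OF br \<kappa>]) (simp only: y[OF z(1)] z(2))
  qed
  \<comment> \<open>The eigenvalue at \<open>?h\<close> is prescribed, because \<open>SOME\<close> yields a determined value only where one
    of the eigenvectors \<open>loop_elem x m b\<close>, \<open>loop_elem y (- m) b\<close> is nonzero.\<close>
  define \<beta> where "\<beta> U = (if U = ?h then 2 else SOME c. ?P U c)" for U
  have \<beta>: "?P U (\<beta> U)" if "U \<in> ?H" for U
  proof (cases "U = ?h")
    case True
    have "\<beta> U = 2"
      unfolding \<beta>_def by (rule if_P) (rule True)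
    moreover have "?P U 2"
      unfolding True by (rule P_h)
    ultimately show ?thesis
      by (simp only: simp_thms)
  next
    case False
    then have \<beta>_U: "\<beta> U = (SOME c. ?P U c)"
      unfolding \<beta>_def by (rule if_not_P)
    show ?thesis
      unfolding \<beta>_U
      by (rule someI_ex) (rule toroidal_cartan_acts_on_opposite_pair[OF br \<kappa> x' y that])
  qed
  define M where "M k = weight_space ?H \<rho> (\<lambda>U. \<mu> U + of_nat k * \<beta> U)" for k :: nat
  have raise: "\<rho> (loop_elem x m b') u \<in> M (Suc k)" if "u \<in> M k" for b' u k
  proof -
    have "?T U (loop_elem x m b') = \<beta> U *\<^sub>C loop_elem x m b'" if "U \<in> ?H" for U
      using \<beta>[OF that] by blast
    from weight_space_shift[OF module this that[unfolded M_def]] show ?thesis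
      by (simp add: M_def algebra_simps)
  qed
  have lower: "\<rho> ?f u \<in> M k" if "u \<in> M (Suc k)" for u k
  proof -
    have "?T U ?f = (- \<beta> U) *\<^sub>C ?f" if "U \<in> ?H" for U
      using \<beta>[OF that] by blast
    from weight_space_shift[OF module this that[unfolded M_def]] show ?thesis
      by (simp add: M_def algebra_simps)
  qed
  have "\<exists>k. M k = {0}"
  proof (rule sl2_weight_string_terminates[of "\<rho> ?e" "\<rho> ?f" "\<rho> ?h" M "\<mu> ?h"])
    show "\<rho> ?e (\<rho> ?f u) = \<rho> ?f (\<rho> ?e u) + \<rho> ?h u" for u
      unfolding act by simp
    have "?T ?h ?e = 2 *\<^sub>C ?e"
      using P_h by blast
    then have "\<rho> ?h (\<rho> ?e u) - \<rho> ?e (\<rho> ?h u) = \<rho> (2 *\<^sub>C ?e) u" for u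
      by (simp only: act[symmetric])
    then show "\<rho> ?h (\<rho> ?e u) = \<rho> ?e (\<rho> ?h u) + 2 *\<^sub>C \<rho> ?e u" for u
      by (simp only: cbilinearD(3)[OF \<rho>] diff_eq_eq add.commute)
    have "\<beta> ?h = 2"
      unfolding \<beta>_def by (rule if_P) (rule refl)
    then show "\<rho> ?h u = (\<mu> ?h + 2 * of_nat k) *\<^sub>C u" if "u \<in> M k" for k u
      using bspec[OF that[unfolded M_def weight_space_def mem_Collect_eq] hH]
      by (simp only: mult.commute)
    show "\<exists>n. (\<rho> ?e ^^ n) u = 0" for u
      using nil \<alpha> x unfolding real_root_vectors_locally_nilpotent_def by blast
    show "csubspace (M k)" "finite_dim (M k)" for k
      unfolding M_def by (rule weight_space_subspace[OF \<rho>], rule finite_dim_weight_space[OF \<rho> H fd])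
  qed (fact lin raise lower)+
  then obtain k where k: "M k = {0}"
    by blast
  have "(\<rho> (loop_elem x m b) ^^ n) v \<in> M n" for n
  proof (induction n)
    case 0
    show ?case
      using v by (simp add: M_def)
  next
    case (Suc n)
    then show ?case
      by (simp only: funpow.simps comp_apply raise)
  qed
  then show ?thesis
    using k by blast
qed

section \<open>Integrability\<close>

lemma weight_module_decomposition:
  assumes "weight_module H \<rho>"
  shows "\<exists>I g. finite I \<and> (\<forall>\<mu>\<in>I. g \<mu> \<in> weight_space H \<rho> \<mu>) \<and> v = (\<Sum>\<mu>\<in>I. g \<mu>)"
proof -
  obtain p where "Poly_Mapping.keys p \<subseteq> dual_space H"
    "\<forall>\<mu>\<in>dual_space H. Poly_Mapping.lookup p \<mu> \<in> weight_space H \<rho> \<mu>"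
    "v = (\<Sum>\<mu>\<in>Poly_Mapping.keys p. Poly_Mapping.lookup p \<mu>)"
    using assms unfolding weight_module_def is_direct_sum_def by blast
  then show ?thesis
    by (intro exI[of _ "Poly_Mapping.keys p"] exI[of _ "Poly_Mapping.lookup p"]) auto
qed

theorem lemma3p1:
  fixes br :: "'g::complex_vector \<Rightarrow> 'g \<Rightarrow> 'g"
    and \<hh> :: "'g set"
    and \<kappa> :: "'g \<Rightarrow> 'g \<Rightarrow> complex"
    and \<rho> :: "('g, 'n::finite, 'b::complex_comm_algebra_1) tau_loop \<Rightarrow> 'v::complex_vector \<Rightarrow> 'v"
  assumes "simple_lie_algebra br" and "finite_dim (UNIV :: 'g set)"
    and "cartan_subalgebra br \<hh>"
    and "normalized_form br \<hh> \<kappa>"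
    and "finitely_generated_algebra TYPE('b)"
    and "lie_module (tau_loop_bracket br \<kappa>) \<rho>"
    and "\<forall>\<mu>\<in>dual_space (toroidal_cartan \<hh>). finite_dim (weight_space (toroidal_cartan \<hh>) \<rho> \<mu>)"
  shows "integrable_tau_loop br \<hh> \<rho> \<longleftrightarrow> integrable_tau br \<hh> \<rho>"
proof
  assume "integrable_tau_loop br \<hh> \<rho>"
  then show "integrable_tau br \<hh> \<rho>"
    by (simp add: integrable_tau_loop_def integrable_tau_def)
next
  assume "integrable_tau br \<hh> \<rho>"
  then have weight: "weight_module (toroidal_cartan \<hh>) \<rho>"
    and nil: "real_root_vectors_locally_nilpotent br \<hh> \<rho> 1"
    by (simp_all add: integrable_tau_def)
  have form: "invariant_form br \<kappa>"
    using assms(4) by (simp add: normalized_form_def)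
  have "\<exists>k. (\<rho> (loop_elem x m b) ^^ k) v = 0"
    if \<alpha>: "\<alpha> \<in> roots br \<hh>" and x: "root_vector br \<hh> \<alpha> x" for \<alpha> x m b v
  proof -
    have lin: "clinear (\<rho> (loop_elem x m b))"
      using assms(6) unfolding lie_module_def cbilinear_def by blast
    obtain I g where I: "finite I" "\<forall>\<mu>\<in>I. g \<mu> \<in> weight_space (toroidal_cartan \<hh>) \<rho> \<mu>"
      and v: "v = (\<Sum>\<mu>\<in>I. g \<mu>)"
      using weight_module_decomposition[OF weight] by blast
    have "\<exists>k. (\<rho> (loop_elem x m b) ^^ k) (g \<mu>) = 0" if "\<mu> \<in> I" for \<mu>
      using root_vector_nilpotent_on_weight_vector[OF assms(1-3) form assms(6,7) nil \<alpha> x] I(2) that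
      by blast
    then obtain N where N: "\<forall>u\<in>cspan (g ` I). (\<rho> (loop_elem x m b) ^^ N) u = 0"
      using uniformly_nilpotent_on_finite_span[OF lin, of "g ` I"] I(1) by blast
    have "v \<in> cspan (g ` I)"
      unfolding v by (intro complex_vector.span_sum complex_vector.span_base imageI)
    with N show ?thesis
      by blast
  qed
  then show "integrable_tau_loop br \<hh> \<rho>"
    using weight unfolding integrable_tau_loop_def real_root_vectors_locally_nilpotent_def by blast
qed

end
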